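(* Let $\lambda\ge0$ and $\hat w\in\mathbb R$ be fixed. Let $\alpha,\beta\in C^{1,2}([0,T]\times\mathbb R^D)\cap\Upsilon(2)$. Assume that $\alpha\in\Upsilon(0)\cap\Upsilon(1)$ and $\alpha>0$, and that $\alpha,\beta$ solve the following system of partial integro-differential equations pointwise on $[0,T)\times\mathbb R^D$: $$\begin{cases}\partial_t\alpha(t,y)+\mathcal L_Y\alpha(t,y)-(\mathscr M_\alpha^{\mathsf T}\mathscr S_\alpha^{-1}\mathscr M_\alpha)(t,y)=0,\\ \partial_t\beta(t,y)+\mathcal L_Y\beta(t,y)-\frac\lambda2\log\Big(\frac{(\lambda\pi)^D}{\det(\mathscr S_\alpha(t,y))}\Big)=0,\\ \alpha(T,\cdot)\equiv1\quad\text{and}\quad\beta(T,\cdot)\equiv0.\end{cases}$$ Then the function $$v^{\mathrm{opt}}(t,x,y)=\alpha(t,y)(x-\hat w)^2+\beta(t,y),\qquad(t,x,y)\in[0,T]\times\mathbb R\times\mathbb R^D,$$ solves the Hamilton–Jacobi–Bellman equation $$\begin{aligned}0&=\partial_tv(t,x,y)+b(y)^{\mathsf T}\nabla_yv(t,x,y)+\tfrac12\mathrm{tr}[A(y)\nabla^2_{yy}v(t,x,y)]\\&\quad+\min_{F\in\mathcal A}\Big\{\tfrac12\partial^2_{xx}v(t,x,y)\big((m^F)^{\mathsf T}A(y)m^F+\mathrm{tr}[A(y)\theta^F]\big)+(m^F)^{\mathsf T}\big(A(y)\nabla^2_{xy}v(t,x,y)+\partial_xv(t,x,y)b(y)\big)\\&\qquad+\int_{E\times\mathbb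 R^D}\big(v(t,x+F(u)^{\mathsf T}\gamma(y)e,y+\gamma(y)e)-v(t,x,y)-\partial_xv(t,x,y)F(u)^{\mathsf T}\gamma(y)e-\nabla_yv(t,x,y)^{\mathsf T}\gamma(y)e\big)\nu(de)\varphi_D(u)du\\&\qquad-\lambda\,\mathsf{Ent}(F)\Big\},\qquad(t,x,y)\in[0,T)\times\mathbb R\times\mathbb R^D,\end{aligned}$$ with terminal condition $v(T,x,y)=(x-\hat w)^2$ for $(x,y)\in\mathbb R\times\mathbb R^D$. Moreover, a minimizer $F^{\mathrm{opt}}_\alpha(t,x,y;\lambda;\cdot)\in\mathcal A$ (for $v=v^{\mathrm{opt}}$ at $(t,x,y)$) is $$F^{\mathrm{opt}}_\alpha(t,x,y;\lambda;u)=m^{\mathrm{opt}}_\alpha(t,x,y)+\theta^{\mathrm{opt}}_\alpha(t,y;\lambda)^{1/2}u,$$ where $m^{\mathrm{opt}}_\alpha(t,x,y)=-(x-\hat w)(\mathscr S_\alpha^{-1}\mathscr M_\alpha)(t,y)$ and $\theta^{\mathrm{opt}}_\alpha(t,y;\lambda)=\frac\lambda2\mathscr S_\alpha^{-1}(t,y)$.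
   Context: Notation: $D\in\mathbb N$, $T\in(0,\infty)$; $E=\mathbb R^D\setminus\{0\}$; $\varphi_D$ is the density of $\mathcal N(0,I_D)$; $\mathbb S^D_{++}$ is the set of symmetric positive definite $D\times D$ matrices; $B^{1/2}$ is the symmetric positive semidefinite square root. $\nabla_y,\nabla^2_{yy}$ are gradient and Hessian in $y$; $\nabla^2_{xy}v=(\partial^2_{xy^{(1)}}v,\dots,\partial^2_{xy^{(D)}}v)^{\mathsf T}$. $C^{1,2}([0,T]\times\mathbb R^D)$: functions once continuously differentiable in $t\in[0,T]$ and twice in $y\in\mathbb R^D$ with jointly continuous partial derivatives. The constant $\lambda\ge0$ is the exploration weight. Standing assumptions: $\nu$ is a Lévy measure on $E$ with $\int_E\|e\|^2\nu(de)<\infty$; $b\colon\mathbb R^D\to\mathbb R^D$ and $a,\gamma\colon\mathbb R^D\to\mathbb R^{D\times D}$ are Lipschitz continuous with linear growth; $A=aa^{\mathsf T}$; $\Sigma(y)=A(y)+\gamma(y)\int_Eee^{\mathsf T}\nu(de)\gamma(y)^{\mathsf T}\in\mathbb S^D_{++}$ for all $y\in\mathbb R^D$. The operator $\mathcal L_Y$ is $$\mathcal L_Yf(y)=b(y)^{\mathsf T}\nabla f(y)+\tfrac12\mathrm{tr}[A(y)\nabla^2f(y)]+\int_E\big(f(y+\gamma(y)z)-f(y)-\nabla f(y)^{\mathsf T}\gamma(y)z\big)\nu(dz),$$ and $\mathcal L_Y\phi(t,y)=(\mathcal L_Y\phi(t,\cdot))(y)$. Classes $\Upsilon(k)$: a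 Borel $g\colon[0,T]\times\mathbb R^D\to\mathbb R$ is in $\Upsilon(0)$ (resp. $\Upsilon(1)$, $\Upsilon(2)$) if there is a continuous function $[0,T]\times\mathbb R^D\to[0,\infty)$ dominating, for all $(t,y)$, $\int_E|g(t,y+\gamma(y)e)|\|e\|^2\nu(de)$ (resp. $\int_E|g(t,y+\gamma(y)e)-g(t,y)|\|e\|\nu(de)$; resp. $\int_E|g(t,y+\gamma(y)e)-g(t,y)-\nabla_yg(t,y)^{\mathsf T}\gamma(y)e|\nu(de)$, where $\nabla_yg$ is assumed to exist and be measurable). For $\alpha\in\Upsilon(0)\cap\Upsilon(1)$, $\alpha>0$, with $\nabla_y\alpha$ existing: $$\mathscr M_\alpha(t,y)=\alpha(t,y)b(y)+A(y)\nabla_y\alpha(t,y)+\gamma(y)\int_E(\alpha(t,y+\gamma(y)e)-\alpha(t,y))e\,\nu(de)\in\mathbb R^D,$$ $$\mathscr S_\alpha(t,y)=\alpha(t,y)A(y)+\gamma(y)\Big(\int_E\alpha(t,y+\gamma(y)e)ee^{\mathsf T}\nu(de)\Big)\gamma(y)^{\mathsf T}\in\mathbb S^D_{++}.$$ Class $\mathcal A$: Borel $F\colon\mathbb R^D\to\mathbb R^D$ with $\int\|F(u)\|^2\varphi_D(u)du<\infty$ such that $F(\xi)$, $\xi\sim\mathcal N(0,I_D)$, has a probability density $p^F$. For $F\in\mathcal A$: $m^F=\int F(u)\varphi_D(u)du$, $\theta^F=\int(F(u)-m^F)(F(u)-m^F)^{\mathsf T}\varphi_D(u)du$, and $\mathsf{Ent}(F)=-\int_{\mathbb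 R^D}p^F(u)\log p^F(u)du$ (differential entropy).
   Formalization: For λ=0 the constant F^opt has no density, so it is not in 𝒜 and the minimum over 𝒜 is not attained; there the equation is stated with an infimum over 𝒜, equal to the value at F^opt, which minimizes over all square-integrable Borel maps. *)

theory Defs
  imports "HOL-Probability.Probability"
begin

section \<open>Derivatives and the class \<open>C\<^sup>1\<^sup>,\<^sup>2\<close>\<close>

definition has_pd :: "('a::real_normed_vector \<Rightarrow> real) \<Rightarrow> 'a \<Rightarrow> 'a \<Rightarrow> bool" where
  "has_pd f i y \<longleftrightarrow> (\<lambda>s::real. f (y + s *\<^sub>R i)) differentiable (at 0)"

definition pd :: "'a::real_normed_vector \<Rightarrow> ('a \<Rightarrow> real) \<Rightarrow> 'a \<Rightarrow> real" where
  "pd i f y = deriv (\<lambda>s::real. f (y + s *\<^sub>R i)) 0"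

definition grad :: "(real ^ 'n \<Rightarrow> real) \<Rightarrow> real ^ 'n \<Rightarrow> real ^ 'n" where
  "grad f y = (\<chi> i. pd (axis i 1) f y)"

definition hess :: "(real ^ 'n \<Rightarrow> real) \<Rightarrow> real ^ 'n \<Rightarrow> real ^ 'n ^ 'n" where
  "hess f y = (\<chi> i j. pd (axis i 1) (pd (axis j 1) f) y)"

text \<open>Functions on \<open>[0,T] \<times> \<real>\<^sup>D\<close> are curried total functions of which only the values at
  times in \<open>{0..T}\<close> matter; the time derivative is therefore taken within \<open>{0..T}\<close>
  (one-sided at the endpoints).\<close>

definition dt :: "real \<Rightarrow> (real \<Rightarrow> 'a \<Rightarrow> real) \<Rightarrow> real \<Rightarrow> 'a \<Rightarrow> real" where
  "dt T f t y = vector_derivative (\<lambda>s. f s y) (at t within {0..T})"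

definition C12 :: "real \<Rightarrow> (real \<Rightarrow> 'a::euclidean_space \<Rightarrow> real) set" where
  "C12 T = {f.
     continuous_on ({0..T} \<times> UNIV) (\<lambda>(t, y). f t y) \<and>
     (\<forall>t\<in>{0..T}. \<forall>y. (\<lambda>s. f s y) differentiable (at t within {0..T})) \<and>
     continuous_on ({0..T} \<times> UNIV) (\<lambda>(t, y). dt T f t y) \<and>
     (\<forall>i\<in>Basis.
        (\<forall>t\<in>{0..T}. \<forall>y. has_pd (f t) i y) \<and>
        continuous_on ({0..T} \<times> UNIV) (\<lambda>(t, y). pd i (f t) y) \<and>
        (\<forall>j\<in>Basis.
           (\<forall>t\<in>{0..T}. \<forall>y. has_pd (pd i (f t)) j y) \<and>
           continuous_on ({0..T} \<times> UNIV) (\<lambda>(t, y). pd j (pd i (f t)) y)))}"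

section \<open>Matrices\<close>

definition outer :: "real ^ 'n \<Rightarrow> real ^ 'n \<Rightarrow> real ^ 'n ^ 'n" where
  "outer u w = (\<chi> i j. u $ i * w $ j)"

definition pos_def :: "real ^ 'n ^ 'n \<Rightarrow> bool" where
  "pos_def B \<longleftrightarrow> transpose B = B \<and> (\<forall>x. x \<noteq> 0 \<longrightarrow> 0 < x \<bullet> (B *v x))"

definition pos_semidef :: "real ^ 'n ^ 'n \<Rightarrow> bool" where
  "pos_semidef B \<longleftrightarrow> transpose B = B \<and> (\<forall>x. 0 \<le> x \<bullet> (B *v x))"

definition mat_sqrt :: "real ^ 'n ^ 'n \<Rightarrow> real ^ 'n ^ 'n" where
  "mat_sqrt B = (THE R. pos_semidef R \<and> R ** R = B)"

section \<open>The model\<close>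

text \<open>A measure on \<open>E = \<real>\<^sup>D - {0}\<close> is represented by its extension to \<open>\<real>\<^sup>D\<close> that does
  not charge the origin, so integrals over \<open>E\<close> are integrals over the whole space.\<close>

definition levy_measure :: "(real ^ 'n) measure \<Rightarrow> bool" where
  "levy_measure \<nu> \<longleftrightarrow> sets \<nu> = sets borel \<and> emeasure \<nu> {0} = 0 \<and>
     (\<integral>\<^sup>+ e. ennreal (min 1 ((norm e)\<^sup>2)) \<partial>\<nu>) < \<infinity>"

definition lipschitz_lin_growth :: "('a::real_normed_vector \<Rightarrow> 'b::real_normed_vector) \<Rightarrow> bool" where
  "lipschitz_lin_growth f \<longleftrightarrow>
     (\<exists>L. L-lipschitz_on UNIV f) \<and> (\<exists>K. \<forall>y. norm (f y) \<le> K * (1 + norm y))"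

definition diffA :: "(real ^ 'n \<Rightarrow> real ^ 'n ^ 'n) \<Rightarrow> real ^ 'n \<Rightarrow> real ^ 'n ^ 'n" where
  "diffA a y = a y ** transpose (a y)"

definition Sigma_mat ::
  "(real ^ 'n \<Rightarrow> real ^ 'n ^ 'n) \<Rightarrow> (real ^ 'n \<Rightarrow> real ^ 'n ^ 'n) \<Rightarrow> (real ^ 'n) measure
     \<Rightarrow> real ^ 'n \<Rightarrow> real ^ 'n ^ 'n" where
  "Sigma_mat a \<gamma> \<nu> y =
     diffA a y + \<gamma> y ** (\<integral>e. outer e e \<partial>\<nu>) ** transpose (\<gamma> y)"

definition L_Y ::
  "(real ^ 'n \<Rightarrow> real ^ 'n) \<Rightarrow> (real ^ 'n \<Rightarrow> real ^ 'n ^ 'n) \<Rightarrow> (real ^ 'n \<Rightarrow> real ^ 'n ^ 'n)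
     \<Rightarrow> (real ^ 'n) measure \<Rightarrow> (real ^ 'n \<Rightarrow> real) \<Rightarrow> real ^ 'n \<Rightarrow> real" where
  "L_Y b a \<gamma> \<nu> f y =
     b y \<bullet> grad f y + 1/2 * trace (diffA a y ** hess f y)
     + (\<integral>z. f (y + \<gamma> y *v z) - f y - grad f y \<bullet> (\<gamma> y *v z) \<partial>\<nu>)"

definition borel_fun :: "real \<Rightarrow> (real \<Rightarrow> real ^ 'n \<Rightarrow> real) \<Rightarrow> bool" where
  "borel_fun T g \<longleftrightarrow>
     (\<lambda>(t, y). g t y) \<in> borel_measurable (restrict_space borel ({0..T} \<times> UNIV))"

definition cont_dominated :: "real \<Rightarrow> (real \<Rightarrow> real ^ 'n \<Rightarrow> ennreal) \<Rightarrow> bool" where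
  "cont_dominated T G \<longleftrightarrow>
     (\<exists>h :: real \<Rightarrow> real ^ 'n \<Rightarrow> real.
        continuous_on ({0..T} \<times> UNIV) (\<lambda>(t, y). h t y) \<and>
        (\<forall>t\<in>{0..T}. \<forall>y. 0 \<le> h t y \<and> G t y \<le> ennreal (h t y)))"

definition Upsilon0 ::
  "real \<Rightarrow> (real ^ 'n \<Rightarrow> real ^ 'n ^ 'n) \<Rightarrow> (real ^ 'n) measure
     \<Rightarrow> (real \<Rightarrow> real ^ 'n \<Rightarrow> real) set" where
  "Upsilon0 T \<gamma> \<nu> = {g. borel_fun T g \<and>
     cont_dominated T (\<lambda>t y. \<integral>\<^sup>+ e. ennreal (\<bar>g t (y + \<gamma> y *v e)\<bar> * (norm e)\<^sup>2) \<partial>\<nu>)}"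

definition Upsilon1 ::
  "real \<Rightarrow> (real ^ 'n \<Rightarrow> real ^ 'n ^ 'n) \<Rightarrow> (real ^ 'n) measure
     \<Rightarrow> (real \<Rightarrow> real ^ 'n \<Rightarrow> real) set" where
  "Upsilon1 T \<gamma> \<nu> = {g. borel_fun T g \<and>
     cont_dominated T (\<lambda>t y. \<integral>\<^sup>+ e. ennreal (\<bar>g t (y + \<gamma> y *v e) - g t y\<bar> * norm e) \<partial>\<nu>)}"

definition Upsilon2 ::
  "real \<Rightarrow> (real ^ 'n \<Rightarrow> real ^ 'n ^ 'n) \<Rightarrow> (real ^ 'n) measure
     \<Rightarrow> (real \<Rightarrow> real ^ 'n \<Rightarrow> real) set" where
  "Upsilon2 T \<gamma> \<nu> = {g. borel_fun T g \<and>
     (\<forall>t\<in>{0..T}. \<forall>y i. has_pd (g t) (axis i 1) y) \<and>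
     (\<forall>i. borel_fun T (\<lambda>t y. grad (g t) y $ i)) \<and>
     cont_dominated T (\<lambda>t y.
       \<integral>\<^sup>+ e. ennreal \<bar>g t (y + \<gamma> y *v e) - g t y - grad (g t) y \<bullet> (\<gamma> y *v e)\<bar> \<partial>\<nu>)}"

definition scriptM ::
  "(real ^ 'n \<Rightarrow> real ^ 'n) \<Rightarrow> (real ^ 'n \<Rightarrow> real ^ 'n ^ 'n) \<Rightarrow> (real ^ 'n \<Rightarrow> real ^ 'n ^ 'n)
     \<Rightarrow> (real ^ 'n) measure \<Rightarrow> (real \<Rightarrow> real ^ 'n \<Rightarrow> real) \<Rightarrow> real \<Rightarrow> real ^ 'n \<Rightarrow> real ^ 'n" where
  "scriptM b a \<gamma> \<nu> \<alpha> t y =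
     \<alpha> t y *\<^sub>R b y + diffA a y *v grad (\<alpha> t) y
     + \<gamma> y *v (\<integral>e. (\<alpha> t (y + \<gamma> y *v e) - \<alpha> t y) *\<^sub>R e \<partial>\<nu>)"

definition scriptS ::
  "(real ^ 'n \<Rightarrow> real ^ 'n ^ 'n) \<Rightarrow> (real ^ 'n \<Rightarrow> real ^ 'n ^ 'n)
     \<Rightarrow> (real ^ 'n) measure \<Rightarrow> (real \<Rightarrow> real ^ 'n \<Rightarrow> real) \<Rightarrow> real \<Rightarrow> real ^ 'n \<Rightarrow> real ^ 'n ^ 'n" where
  "scriptS a \<gamma> \<nu> \<alpha> t y =
     \<alpha> t y *\<^sub>R diffA a y
     + \<gamma> y ** (\<integral>e. \<alpha> t (y + \<gamma> y *v e) *\<^sub>R outer e e \<partial>\<nu>) ** transpose (\<gamma> y)"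

section \<open>Exploration maps and differential entropy\<close>

definition gauss :: "(real ^ 'n) measure" where
  "gauss = density lborel (\<lambda>u. ennreal (\<Prod>i\<in>UNIV. std_normal_density (u $ i)))"

text \<open>\<open>class_A\<close> is the class of exploration maps. Dropping its density requirement gives
  \<open>sq_maps\<close>; this is needed for \<open>\<lambda> = 0\<close>, where the minimizer is constant, has no density, and
  the infimum over \<open>class_A\<close> is not attained.\<close>

definition sq_maps :: "(real ^ 'n \<Rightarrow> real ^ 'n) set" where
  "sq_maps = {F. F \<in> borel_measurable borel \<and> integrable gauss (\<lambda>u. (norm (F u))\<^sup>2)}"

definition class_A :: "(real ^ 'n \<Rightarrow> real ^ 'n) set" where
  "class_A = {F \<in> sq_maps. \<exists>p. distributed gauss lborel F p}"

definition map_density :: "(real ^ 'n \<Rightarrow> real ^ 'n) \<Rightarrow> real ^ 'n \<Rightarrow> real" where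
  "map_density F u = enn2real (RN_deriv lborel (distr gauss lborel F) u)"

text \<open>Extended-real valued: \<open>p log p\<close> need not be integrable for \<open>F\<close> in the class, in which case
  the entropy is \<open>-\<infinity>\<close>, whereas the Bochner integral (as used in the library's
  \<open>entropy\<close>) would return \<open>0\<close>. The first term is finite for square integrable \<open>F\<close>, so
  \<open>\<infinity> - \<infinity>\<close> does not arise.\<close>

definition Ent :: "(real ^ 'n \<Rightarrow> real ^ 'n) \<Rightarrow> ereal" where
  "Ent F =
     enn2ereal (\<integral>\<^sup>+ u. ennreal (- (map_density F u * ln (map_density F u))) \<partial>lborel)
     - enn2ereal (\<integral>\<^sup>+ u. ennreal (map_density F u * ln (map_density F u)) \<partial>lborel)"

definition mean_map :: "(real ^ 'n \<Rightarrow> real ^ 'n) \<Rightarrow> real ^ 'n" where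
  "mean_map F = (\<integral>u. F u \<partial>gauss)"

definition cov_map :: "(real ^ 'n \<Rightarrow> real ^ 'n) \<Rightarrow> real ^ 'n ^ 'n" where
  "cov_map F = (\<integral>u. outer (F u - mean_map F) (F u - mean_map F) \<partial>gauss)"

section \<open>The Hamilton--Jacobi--Bellman equation\<close>

text \<open>Value functions \<open>v t x y\<close> have \<open>x\<close> real and \<open>y\<close> in \<open>\<real>\<^sup>D\<close>.\<close>

definition jump_integrand ::
  "(real ^ 'n \<Rightarrow> real ^ 'n ^ 'n) \<Rightarrow> (real \<Rightarrow> real \<Rightarrow> real ^ 'n \<Rightarrow> real)
     \<Rightarrow> real \<Rightarrow> real \<Rightarrow> real ^ 'n \<Rightarrow> (real ^ 'n \<Rightarrow> real ^ 'n) \<Rightarrow> (real ^ 'n) \<times> (real ^ 'n) \<Rightarrow> real" where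
  "jump_integrand \<gamma> v t x y F = (\<lambda>(e, u).
     v t (x + F u \<bullet> (\<gamma> y *v e)) (y + \<gamma> y *v e) - v t x y
     - deriv (\<lambda>x'. v t x' y) x * (F u \<bullet> (\<gamma> y *v e))
     - grad (v t x) y \<bullet> (\<gamma> y *v e))"

text \<open>The expression inside the minimum. For \<open>\<lambda> = 0\<close> the entropy term vanishes even if
  \<open>Ent F = -\<infinity>\<close>, since \<open>0 * \<plusminus>\<infinity> = 0\<close> in \<open>ereal\<close>.\<close>

definition hamiltonian ::
  "(real ^ 'n \<Rightarrow> real ^ 'n) \<Rightarrow> (real ^ 'n \<Rightarrow> real ^ 'n ^ 'n) \<Rightarrow> (real ^ 'n \<Rightarrow> real ^ 'n ^ 'n)
     \<Rightarrow> (real ^ 'n) measure \<Rightarrow> real \<Rightarrow> (real \<Rightarrow> real \<Rightarrow> real ^ 'n \<Rightarrow> real)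
     \<Rightarrow> real \<Rightarrow> real \<Rightarrow> real ^ 'n \<Rightarrow> (real ^ 'n \<Rightarrow> real ^ 'n) \<Rightarrow> ereal" where
  "hamiltonian b a \<gamma> \<nu> lam v t x y F =
     ereal (
       1/2 * deriv (deriv (\<lambda>x'. v t x' y)) x
           * (mean_map F \<bullet> (diffA a y *v mean_map F) + trace (diffA a y ** cov_map F))
       + mean_map F \<bullet>
           (diffA a y *v (\<chi> i. deriv (\<lambda>x'. grad (v t x') y $ i) x)
            + deriv (\<lambda>x'. v t x' y) x *\<^sub>R b y)
       + (\<integral>p. jump_integrand \<gamma> v t x y F p \<partial>(\<nu> \<Otimes>\<^sub>M gauss)))
     - ereal lam * Ent F"

definition v_opt ::
  "real \<Rightarrow> (real \<Rightarrow> real ^ 'n \<Rightarrow> real) \<Rightarrow> (real \<Rightarrow> real ^ 'n \<Rightarrow> real)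
     \<Rightarrow> real \<Rightarrow> real \<Rightarrow> real ^ 'n \<Rightarrow> real" where
  "v_opt w \<alpha> \<beta> t x y = \<alpha> t y * (x - w)\<^sup>2 + \<beta> t y"

definition m_opt ::
  "(real ^ 'n \<Rightarrow> real ^ 'n) \<Rightarrow> (real ^ 'n \<Rightarrow> real ^ 'n ^ 'n) \<Rightarrow> (real ^ 'n \<Rightarrow> real ^ 'n ^ 'n)
     \<Rightarrow> (real ^ 'n) measure \<Rightarrow> real \<Rightarrow> (real \<Rightarrow> real ^ 'n \<Rightarrow> real)
     \<Rightarrow> real \<Rightarrow> real \<Rightarrow> real ^ 'n \<Rightarrow> real ^ 'n" where
  "m_opt b a \<gamma> \<nu> w \<alpha> t x y =
     - (x - w) *\<^sub>R (matrix_inv (scriptS a \<gamma> \<nu> \<alpha> t y) *v scriptM b a \<gamma> \<nu> \<alpha> t y)"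

definition theta_opt ::
  "(real ^ 'n \<Rightarrow> real ^ 'n ^ 'n) \<Rightarrow> (real ^ 'n \<Rightarrow> real ^ 'n ^ 'n)
     \<Rightarrow> (real ^ 'n) measure \<Rightarrow> real \<Rightarrow> (real \<Rightarrow> real ^ 'n \<Rightarrow> real)
     \<Rightarrow> real \<Rightarrow> real ^ 'n \<Rightarrow> real ^ 'n ^ 'n" where
  "theta_opt a \<gamma> \<nu> lam \<alpha> t y = (lam / 2) *\<^sub>R matrix_inv (scriptS a \<gamma> \<nu> \<alpha> t y)"

definition F_opt ::
  "(real ^ 'n \<Rightarrow> real ^ 'n) \<Rightarrow> (real ^ 'n \<Rightarrow> real ^ 'n ^ 'n) \<Rightarrow> (real ^ 'n \<Rightarrow> real ^ 'n ^ 'n)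
     \<Rightarrow> (real ^ 'n) measure \<Rightarrow> real \<Rightarrow> real \<Rightarrow> (real \<Rightarrow> real ^ 'n \<Rightarrow> real)
     \<Rightarrow> real \<Rightarrow> real \<Rightarrow> real ^ 'n \<Rightarrow> real ^ 'n \<Rightarrow> real ^ 'n" where
  "F_opt b a \<gamma> \<nu> lam w \<alpha> t x y u =
     m_opt b a \<gamma> \<nu> w \<alpha> t x y + mat_sqrt (theta_opt a \<gamma> \<nu> lam \<alpha> t y) *v u"

end

(* At fixed (t, x, y) put c = x - w. By Fubini the Hamiltonian of the quadratic ansatz depends on F
   only through E[F.SF] + 2 c E[F].M - lam Ent(F). Completing the square around
   m = - c S^-1 M turns this into E[(F - m).S(F - m)] - lam Ent(F) plus a constant. For lam > 0 the
   weight (F - m).S(F - m) / lam is, up to a constant, minus the logarithm of the density of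
   N(m, lam/2 S^-1), so Gibbs' inequality for that single reference density gives the minimum and
   shows that the Gaussian map attains it; no optimization over covariance matrices is needed.
   For lam = 0 the infimum is approached by the nondegenerate maps m + eps u. The constants then
   cancel by the two integro-differential equations. *)
theory Submission
  imports Defs
begin

text \<open>Two obstacles shape the work. First, p log p need not be integrable for the density p of
  a map in \<open>class_A\<close>, so the entropy is extended-real; it is bounded above by comparing
  with a reference density q whose logarithm is quadratic and therefore integrable along every
  square integrable map. The normalization of that q produces the constant lam/2 ln((lam pi)^D / det
  S), which is exactly the source term in the equation for beta, while the remainder - c^2 M.S^-1 M
  of the completed square is the nonlinear term in the equation for alpha. Second, alpha is positive
  but may come arbitrarily close to 0 along the jumps, so positive definiteness of S cannot be read
  off from that of \<open>Sigma_mat\<close> by a constant factor; it is inherited through a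
  comparison of null sets. Fubini also needs a sigma-finite nu, which the second moment
  provides.\<close>

section \<open>Square roots of positive semidefinite matrices\<close>

text \<open>Variational argument: a maximizer v of w.f(w) on the unit sphere of the invariant
  subspace is an eigenvector, since otherwise moving v in the direction of the residual w = f v - c
  v would raise the Rayleigh quotient to first order.\<close>

lemma selfadjoint_eigenvector:
  fixes f :: "'a::euclidean_space \<Rightarrow> 'a"
  assumes f: "linear f" and sym: "\<And>x y. f x \<bullet> y = x \<bullet> f y"
    and S: "subspace S" and inv: "f ` S \<subseteq> S" and ne: "S \<noteq> {0}"
  obtains v c where "v \<in> S" "norm v = 1" "f v = c *\<^sub>R v"
proof -
  interpret f: linear f by (rule f)
  have cont: "continuous_on X f" for X
    using f linear_continuous_on linear_conv_bounded_linear by blast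
  obtain s where s: "s \<in> S" "s \<noteq> 0" using ne S subspace_0 by blast
  have "compact (S \<inter> sphere 0 1)"
    using closed_subspace[OF S] by (simp add: closed_Int_compact)
  moreover have "(1 / norm s) *\<^sub>R s \<in> S \<inter> sphere 0 1"
    using s S by (simp add: subspace_scale)
  ultimately obtain v where v: "v \<in> S" "norm v = 1"
    and max: "\<And>w. w \<in> S \<Longrightarrow> norm w = 1 \<Longrightarrow> w \<bullet> f w \<le> v \<bullet> f v"
    using continuous_attains_sup[of "S \<inter> sphere 0 1" "\<lambda>w. w \<bullet> f w"]
      continuous_on_inner[OF continuous_on_id cont[of "S \<inter> sphere 0 1"]]
    by fastforce
  define c where "c = v \<bullet> f v"
  have quad: "w \<bullet> f w \<le> c * (w \<bullet> w)" if "w \<in> S" for w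
  proof (cases "w = 0")
    case False
    have "((1 / norm w) *\<^sub>R w) \<bullet> f ((1 / norm w) *\<^sub>R w) \<le> c"
      unfolding c_def using that False S by (intro max) (auto simp: subspace_scale)
    then show ?thesis
      using False by (simp add: f.scaleR field_simps flip: power2_norm_eq_inner power2_eq_square)
  qed (simp add: f.zero)
  define w where "w = f v - c *\<^sub>R v"
  have wS: "w \<in> S" unfolding w_def using v inv S by (auto intro!: subspace_diff subspace_scale)
  have vv: "v \<bullet> v = 1" using v by (simp add: norm_eq_1)
  have vw: "v \<bullet> w = 0" unfolding w_def c_def by (simp add: inner_diff_right vv)
  have fw: "f v \<bullet> w = w \<bullet> w" using vw by (simp add: w_def inner_diff_left algebra_simps)
  have "w = 0"
  proof (rule ccontr)
    assume "w \<noteq> 0"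
    then have ww: "0 < w \<bullet> w" by simp
    define K where "K = c * (w \<bullet> w) - w \<bullet> f w"
    \<comment> \<open>This is \<open>quad\<close> at v + s w: the gain is linear in s, the
      correction quadratic, so a small positive s gives a contradiction.\<close>
    have key: "2 * s * (w \<bullet> w) \<le> s\<^sup>2 * K" for s :: real
    proof -
      have "(v + s *\<^sub>R w) \<bullet> f (v + s *\<^sub>R w) \<le> c * ((v + s *\<^sub>R w) \<bullet> (v + s *\<^sub>R w))"
        using v wS S by (intro quad) (auto intro: subspace_add subspace_scale)
      moreover have "(v + s *\<^sub>R w) \<bullet> f (v + s *\<^sub>R w) = c + 2 * s * (w \<bullet> w) + s\<^sup>2 * (w \<bullet> f w)"
        using fw sym[of v w]
        by (simp add: f.add f.scaleR inner_add_left inner_add_right c_def power2_eq_square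
            inner_commute[of w "f v"] algebra_simps)
      moreover have "(v + s *\<^sub>R w) \<bullet> (v + s *\<^sub>R w) = 1 + s\<^sup>2 * (w \<bullet> w)"
        using vw by (simp add: inner_add_left inner_add_right vv power2_eq_square inner_commute[of w v])
      ultimately show ?thesis unfolding K_def by (simp only: right_diff_distrib distrib_left)
        (simp add: mult_ac)
    qed
    \<comment> \<open>Small enough that s K \<le> w.w; the summand 1 keeps the denominator positive
      when K = 0.\<close>
    define s where "s = (w \<bullet> w) / (1 + \<bar>K\<bar>)"
    have s: "s > 0" using ww by (simp add: s_def add_pos_nonneg)
    have "2 * (w \<bullet> w) \<le> s * K"
      using key[of s] s by (simp add: power2_eq_square)
    also have "\<dots> \<le> s * (1 + \<bar>K\<bar>)" using s by (intro mult_left_mono) auto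
    also have "\<dots> = w \<bullet> w" by (simp add: s_def add_pos_nonneg)
    finally show False using ww by simp
  qed
  then show thesis using that[of v c] v by (simp add: w_def)
qed

text \<open>Induction on the dimension: one eigenvector v is split off, and symmetry of f makes the
  orthogonal complement of v in S invariant again.\<close>

lemma selfadjoint_eigenbasis:
  fixes f :: "'a::euclidean_space \<Rightarrow> 'a"
  assumes f: "linear f" and sym: "\<And>x y. f x \<bullet> y = x \<bullet> f y"
    and "subspace S" and "f ` S \<subseteq> S"
  shows "\<exists>B. pairwise orthogonal B \<and> (\<forall>v\<in>B. norm v = 1 \<and> (\<exists>c. f v = c *\<^sub>R v)) \<and> span B = S"
  using assms(3,4)
proof (induction "dim S" arbitrary: S rule: less_induct)
  case less
  interpret f: linear f by (rule f)
  show ?case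
  proof (cases "S = {0}")
    case True
    then show ?thesis by (intro exI[of _ "{}"]) auto
  next
    case False
    obtain v c where v: "v \<in> S" "norm v = 1" "f v = c *\<^sub>R v"
      using selfadjoint_eigenvector[OF f sym less.prems False] by metis
    have vv: "v \<bullet> v = 1" using v by (simp add: norm_eq_1)
    define S' where "S' = S \<inter> {x. v \<bullet> x = 0}"
    have S': "subspace S'" unfolding S'_def
      by (intro subspace_inter less.prems subspace_hyperplane)
    have "v \<notin> S'" using vv by (simp add: S'_def)
    moreover have "S' \<subseteq> S" by (simp add: S'_def)
    ultimately have "S' \<subset> S" using v by blast
    then have dim: "dim S' < dim S"
      using S' less.prems(1) by (metis dim_psubset span_eq_iff)
    have "f ` S' \<subseteq> S'"
    proof -
      have "v \<bullet> f x = 0" if "v \<bullet> x = 0" for x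
        using sym[of v x] v that by simp
      then show ?thesis using less.prems(2) by (auto simp: S'_def)
    qed
    then obtain B where B: "pairwise orthogonal B" "\<forall>v\<in>B. norm v = 1 \<and> (\<exists>c. f v = c *\<^sub>R v)"
      "span B = S'"
      using less.hyps[OF dim S'] by blast
    have "B \<subseteq> S'" using B(3) span_superset by blast
    have 1: "pairwise orthogonal (insert v B)"
      using B(1) \<open>B \<subseteq> S'\<close>
      by (auto simp: pairwise_insert S'_def orthogonal_def inner_commute)
    have 2: "span (insert v B) = S"
    proof
      show "span (insert v B) \<subseteq> S"
        using \<open>B \<subseteq> S'\<close> v less.prems(1) by (intro span_minimal) (auto simp: S'_def)
      show "S \<subseteq> span (insert v B)"
      proof
        fix x assume "x \<in> S"
        then have "x - (v \<bullet> x) *\<^sub>R v \<in> span B"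
          unfolding B(3) S'_def using v less.prems(1) vv
          by (auto simp: inner_diff_right intro: subspace_diff subspace_scale)
        then show "x \<in> span (insert v B)" unfolding span_insert by auto
      qed
    qed
    show ?thesis
      using 1 2 B(2) v by (intro exI[of _ "insert v B"]) auto
  qed
qed

lemma transpose_inner: "(A *v x) \<bullet> y = x \<bullet> (transpose A *v y)" for A :: "real^'n^'m"
  by (metis dot_lmul_matrix inner_commute transpose_matrix_vector)

lemma symmetric_inner:
  "transpose A = A \<Longrightarrow> (A *v x) \<bullet> y = x \<bullet> (A *v y)" for A :: "real^'n^'n"
  by (simp add: transpose_inner)

lemma symmetricI:
  fixes A :: "real^'n^'n"
  assumes "\<And>x y. (A *v x) \<bullet> y = x \<bullet> (A *v y)"
  shows "transpose A = A"
proof -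
  have "x \<bullet> (transpose A *v y - A *v y) = 0" for x y
    using assms[of x y] by (simp add: transpose_inner inner_diff_right)
  then have "transpose A *v y = A *v y" for y
    by (metis inner_eq_zero_iff right_minus_eq)
  then show ?thesis by (simp add: matrix_eq)
qed

lemma symmetric_matrix_eigenbasis:
  fixes A :: "real^'n^'n"
  assumes "transpose A = A"
  obtains B where "pairwise orthogonal B" "\<And>v. v \<in> B \<Longrightarrow> norm v = 1"
    "\<And>v. v \<in> B \<Longrightarrow> \<exists>c. A *v v = c *\<^sub>R v" "span B = UNIV" "finite B"
proof -
  obtain B where B: "pairwise orthogonal B" 
    "\<forall>v\<in>B. norm v = 1 \<and> (\<exists>c. A *v v = c *\<^sub>R v)" "span B = UNIV"
    using selfadjoint_eigenbasis[of "(*v) A" UNIV] symmetric_inner[OF assms]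
    by auto
  moreover have "finite B"
  proof -
    have "0 \<notin> B" using B(2) by force
    then show ?thesis
      using pairwise_orthogonal_independent[OF B(1)] independent_imp_finite by blast
  qed
  ultimately show thesis using that by blast
qed

text \<open>Diagonalize and replace each eigenvalue by its square root. The spectral sum
  \<open>r\<close> is compared with A only on the eigenbasis, which spans.\<close>

lemma pos_semidef_sqrt_exists:
  fixes A :: "real^'n^'n"
  assumes A: "pos_semidef A"
  obtains R where "pos_semidef R" "R ** R = A"
proof -
  obtain B where B: "pairwise orthogonal B" "\<And>v. v \<in> B \<Longrightarrow> norm v = 1"
    "\<And>v. v \<in> B \<Longrightarrow> \<exists>c. A *v v = c *\<^sub>R v" "span B = UNIV" "finite B"
    using symmetric_matrix_eigenbasis[of A] A unfolding pos_semidef_def by metis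
  then obtain c where c: "\<And>v. v \<in> B \<Longrightarrow> A *v v = c v *\<^sub>R v" by metis
  have on: "v \<bullet> w = (if v = w then 1 else 0)" if "v \<in> B" "w \<in> B" for v w
    using that B(1,2) by (auto simp: pairwise_def orthogonal_def norm_eq_1)
  have c0: "0 \<le> c v" if "v \<in> B" for v
  proof -
    have "0 \<le> v \<bullet> (A *v v)" using A by (simp add: pos_semidef_def)
    then show ?thesis using c[OF that] on[OF that that] by simp
  qed
  define r where "r x = (\<Sum>v\<in>B. (sqrt (c v) * (v \<bullet> x)) *\<^sub>R v)" for x
  have lin: "linear r"
    unfolding r_def
    by (rule linearI) (simp_all add: inner_add_right algebra_simps sum.distrib scaleR_sum_right)
  define R where "R = matrix r"
  have R: "R *v x = r x" for x using lin by (simp add: R_def)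
  have rB: "r w = sqrt (c w) *\<^sub>R w" if "w \<in> B" for w
  proof -
    have "r w = (\<Sum>v\<in>B. if v = w then sqrt (c w) *\<^sub>R w else 0)"
      unfolding r_def using that by (intro sum.cong) (auto simp: on)
    then show ?thesis using that B(5) by simp
  qed
  have "(R ** R) *v x = A *v x" for x
  proof -
    have "(r \<circ> r) x = (\<lambda>x. A *v x) x"
    proof (rule linear_eq_on[where B = B and f = "r \<circ> r" and g = "(*v) A"])
      show "linear (r \<circ> r)" using lin by (rule linear_compose[OF lin])
      show "(r \<circ> r) w = A *v w" if "w \<in> B" for w
        using rB[OF that] c[OF that] c0[OF that] linear_scale[OF lin] by simp
    qed (use B(4) in auto)
    then show ?thesis by (simp add: R flip: matrix_vector_mul_assoc)
  qed
  then have "R ** R = A" by (simp add: matrix_eq)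
  moreover have "pos_semidef R"
    unfolding pos_semidef_def
  proof
    show "transpose R = R"
      by (rule symmetricI) (simp add: R r_def inner_sum_left inner_sum_right inner_commute mult_ac)
    have "x \<bullet> r x = (\<Sum>v\<in>B. sqrt (c v) * (v \<bullet> x)\<^sup>2)" for x
      by (simp add: r_def inner_sum_right power2_eq_square inner_commute mult_ac)
    then show "\<forall>x. 0 \<le> x \<bullet> (R *v x)" by (auto simp: R c0 intro!: sum_nonneg)
  qed
  ultimately show thesis using that by blast
qed

text \<open>The difference D = R - Q is symmetric and so has an eigenbasis of its own; showing that
  all its eigenvalues vanish avoids comparing the eigenspaces of R with those of Q.\<close>

lemma pos_semidef_sqrt_unique:
  fixes R Q :: "real^'n^'n"
  assumes R: "pos_semidef R" and Q: "pos_semidef Q" and eq: "R ** R = Q ** Q"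
  shows "R = Q"
proof -
  define D where "D = R - Q"
  have tr: "transpose D = D"
    using R Q by (auto simp: D_def pos_semidef_def transpose_def vec_eq_iff)
  obtain B where B: "\<And>v. v \<in> B \<Longrightarrow> norm v = 1"
    "\<And>v. v \<in> B \<Longrightarrow> \<exists>c. D *v v = c *\<^sub>R v" "span B = UNIV"
    using symmetric_matrix_eigenbasis[OF tr] by metis
  have D0: "D *v v = 0" if vB: "v \<in> B" for v
  proof -
    obtain c where c: "D *v v = c *\<^sub>R v" using B(2)[OF vB] by blast
    \<comment> \<open>Since 0 = RR - QQ = RD + DQ, the eigenvalue c satisfies c (v.Rv + v.Qv) = 0.\<close>
    have Rv: "R *v v = c *\<^sub>R v + Q *v v"
      using c by (simp add: D_def algebra_simps)
    have "R *v (R *v v) = Q *v (Q *v v)"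
      using eq by (simp add: matrix_vector_mul_assoc)
    then have "D *v (Q *v v) = - c *\<^sub>R (R *v v)"
      by (simp add: D_def Rv matrix_vector_right_distrib matrix_vector_mult_scaleR algebra_simps)
    then have "v \<bullet> (D *v (Q *v v)) = - c * (v \<bullet> (R *v v))" by simp
    moreover have "v \<bullet> (D *v (Q *v v)) = c * (v \<bullet> (Q *v v))"
      using symmetric_inner[OF tr, of v "Q *v v"] c by simp
    ultimately have "c * (v \<bullet> (R *v v) + v \<bullet> (Q *v v)) = 0" by (simp add: algebra_simps)
    moreover have "v \<bullet> (R *v v) \<ge> 0" "v \<bullet> (Q *v v) \<ge> 0"
      using R Q by (auto simp: pos_semidef_def)
    moreover have "v \<bullet> (R *v v) - v \<bullet> (Q *v v) = c"
      using B(1)[OF vB] by (simp add: Rv inner_add_right norm_eq_1)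
    \<comment> \<open>If c were nonzero, the two nonnegative numbers v.Rv and v.Qv would have sum 0,
      hence both vanish, and so would their difference c.\<close>
    ultimately have "c = 0" by (auto simp: add_nonneg_eq_0_iff)
    then show ?thesis using c by simp
  qed
  have "D *v x = (0::real^'n^'n) *v x" for x
    using linear_eq_on[OF matrix_vector_mul_linear matrix_vector_mul_linear, of x B D 0] B(3) D0
    by auto
  then have "D = 0" unfolding matrix_eq by blast
  then show ?thesis by (simp add: D_def)
qed

text \<open>Existence and uniqueness together give meaning to the definite description in
  \<open>mat_sqrt\<close>.\<close>

lemma mat_sqrt:
  assumes "pos_semidef A"
  shows pos_semidef_mat_sqrt: "pos_semidef (mat_sqrt A)"
    and mat_sqrt_square: "mat_sqrt A ** mat_sqrt A = A"
proof -
  have "\<exists>!R. pos_semidef R \<and> R ** R = A"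
    using pos_semidef_sqrt_exists[OF assms] pos_semidef_sqrt_unique by metis
  from theI'[OF this] show "pos_semidef (mat_sqrt A)" "mat_sqrt A ** mat_sqrt A = A"
    unfolding mat_sqrt_def by auto
qed

lemma pos_def_imp_pos_semidef: "pos_def A \<Longrightarrow> pos_semidef A"
  unfolding pos_def_def pos_semidef_def by (metis inner_zero_left less_eq_real_def)

text \<open>For lam = 0 the covariance is 0, and this makes the optimal map the constant m.\<close>

lemma mat_sqrt_0: "mat_sqrt (0::real^'n^'n) = 0"
proof -
  have "pos_semidef (0::real^'n^'n)"
    by (simp add: pos_semidef_def transpose_def vec_eq_iff)
  then show ?thesis
    using pos_semidef_sqrt_unique[of "mat_sqrt (0::real^'n^'n)" 0] mat_sqrt[of "0::real^'n^'n"]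
    by simp
qed

section \<open>Inverses of positive definite matrices\<close>

lemma pos_def_invertible:
  fixes S :: "real^'n^'n"
  assumes "pos_def S"
  shows "matrix_inv S ** S = mat 1" "S ** matrix_inv S = mat 1" "det S \<noteq> 0"
proof -
  have "x = 0" if "S *v x = 0" for x
    using assms that unfolding pos_def_def by (metis inner_zero_right less_irrefl)
  then have "invertible S"
    using invertible_left_inverse matrix_left_invertible_ker by blast
  \<comment> \<open>\<open>matrix_inv\<close> is a Hilbert choice, meaningful once a two-sided
    inverse is known to exist.\<close>
  then show "matrix_inv S ** S = mat 1" "S ** matrix_inv S = mat 1" "det S \<noteq> 0"
    using someI_ex[of "\<lambda>A'. S ** A' = mat 1 \<and> A' ** S = mat 1"]
    unfolding invertible_det_nz[symmetric] by (auto simp: invertible_def matrix_inv_def)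
qed

text \<open>Writing x = S z turns the quadratic form of the inverse at x into that of S at
  z.\<close>

lemma pos_def_matrix_inv:
  fixes S :: "real^'n^'n"
  assumes S: "pos_def S"
  shows "pos_def (matrix_inv S)"
  unfolding pos_def_def
proof (intro conjI allI impI)
  note inv = pos_def_invertible[OF S]
  have tr: "transpose S = S" using S by (simp add: pos_def_def)
  have id: "S *v (matrix_inv S *v x) = x" for x
    by (simp add: matrix_vector_mul_assoc inv)
  show "transpose (matrix_inv S) = matrix_inv S"
    by (rule symmetricI) (metis id symmetric_inner[OF tr])
  fix x :: "real^'n" assume "x \<noteq> 0"
  then have "matrix_inv S *v x \<noteq> 0" using id[of x] by auto
  then show "0 < x \<bullet> (matrix_inv S *v x)"
    using S id[of x] unfolding pos_def_def by (metis inner_commute)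
qed

lemma pos_def_scaleR: "pos_def S \<Longrightarrow> 0 < c \<Longrightarrow> pos_def (c *\<^sub>R S)"
  unfolding pos_def_def
  by (auto simp: transpose_def vec_eq_iff scaleR_matrix_vector_assoc[symmetric])

section \<open>Linear images of Lebesgue measure\<close>

text \<open>The library has this formula only for a well-ordered index type.\<close>

lemma measure_linear_image_vec:
  fixes f :: "real^'n \<Rightarrow> real^'n"
  assumes "linear f" and "S \<in> lmeasurable"
  shows "f ` S \<in> lmeasurable \<and> measure lebesgue (f ` S) = \<bar>det (matrix f)\<bar> * measure lebesgue S"
proof -
  let ?P = "\<lambda>f :: real^'n \<Rightarrow> real^'n. \<forall>S\<in>lmeasurable.
    f ` S \<in> lmeasurable \<and> measure lebesgue (f ` S) = \<bar>det (matrix f)\<bar> * measure lebesgue S"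
  \<comment> \<open>Swaps and shears preserve volume; for them the formula only has to be tested on
    boxes.\<close>
  have suff: "?P h" if lin: "linear h" and det: "\<bar>det (matrix h)\<bar> = 1"
    and box: "\<And>a b. measure lebesgue (h ` cbox a b) = measure lebesgue (cbox a b)" for h
  proof
    fix S :: "(real^'n) set" assume S: "S \<in> lmeasurable"
    from measure_linear_sufficient[OF lin S, of 1] box
    have "h ` S \<in> lmeasurable" and "measure lebesgue (h ` S) = 1 * measure lebesgue S"
      by (simp_all only: mult_1)
    then show "h ` S \<in> lmeasurable \<and> measure lebesgue (h ` S) = \<bar>det (matrix h)\<bar> * measure lebesgue S"
      unfolding det by blast
  qed
  have "?P f"
  proof (rule induct_linear_elementary[OF \<open>linear f\<close>])
    fix f g :: "real^'n \<Rightarrow> real^'n"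
    assume fg: "linear f" "linear g" "?P f" "?P g"
    then show "?P (f \<circ> g)"
      by (simp only: image_comp[symmetric] matrix_compose[OF fg(2,1)] det_mul abs_mult mult.assoc) auto
  next
    fix f :: "real^'n \<Rightarrow> real^'n" and i
    assume f: "linear f" "\<And>x. f x $ i = 0"
    \<comment> \<open>A map that kills a coordinate is not surjective, hence singular, so both sides
      of the formula are 0.\<close>
    then have "axis i 1 \<notin> range f" by (metis axis_nth imageE one_neq_zero)
    then have "\<not> inj f" using linear_injective_imp_surjective[OF f(1)] by blast
    then have "negligible (f ` S)" and "det (matrix f) = 0" for S
      using negligible_linear_singular_image[OF f(1)] det_nz_iff_inj[OF f(1)] by auto
    then show "?P f" by (auto simp: negligible_iff_measure)
  next
    fix c
    show "?P (\<lambda>x. \<chi> i. c i * x $ i)"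
      using measurable_stretch measure_stretch[of _ c]
      by (auto simp: matrix_def axis_def det_diagonal)
  next
    fix m n :: 'n assume "m \<noteq> n"
    let ?t = "Transposition.transpose m n"
    let ?h = "\<lambda>x :: real^'n. \<chi> i. x $ ?t i"
    have lin: "linear ?h" by (rule linearI) (simp_all add: vec_eq_iff)
    have tt: "?t (?t i) = i" for i by simp
    have hh: "?h (?h x) = x" for x by (simp add: vec_eq_iff)
    have im: "?h ` cbox a b = cbox (?h a) (?h b)" for a b
    proof -
      have "?h x \<in> cbox (?h a) (?h b)" if "x \<in> cbox a b" for x a b
        using that by (simp add: mem_box_cart)
      note mem = this
      show ?thesis
      proof (intro subset_antisym subsetI)
        fix y assume "y \<in> cbox (?h a) (?h b)"
        then have "?h y \<in> cbox a b" using mem[of y "?h a" "?h b"] by (simp only: hh)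
        then have "?h (?h y) \<in> ?h ` cbox a b" by (rule imageI)
        then show "y \<in> ?h ` cbox a b" by (simp only: hh)
      qed (use mem in blast)
    qed
    have "measure lebesgue (?h ` cbox a b) = measure lebesgue (cbox a b)" for a b
    proof (cases "cbox a b = {}")
      case False
      moreover from this have "cbox (?h a) (?h b) \<noteq> {}" unfolding im[symmetric] by simp
      ultimately show ?thesis
        unfolding im using prod.permute[OF permutes_swap_id[of m UNIV n], of "\<lambda>i. b $ i - a $ i"]
        by (simp add: content_cbox_cart o_def)
    qed simp
    \<comment> \<open>A swap is an involution, so its determinant squares to 1; no sign has to be
      computed.\<close>
    moreover have "\<bar>det (matrix ?h)\<bar> = 1"
    proof -
      have "?h \<circ> ?h = id" by (auto simp: vec_eq_iff)
      then have "matrix ?h ** matrix ?h = mat 1"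
        using matrix_compose[OF lin lin] by (simp only: matrix_id_mat_1)
      then have "det (matrix ?h) * det (matrix ?h) = 1"
        by (simp only: det_mul[symmetric] det_I)
      then show ?thesis unfolding power2_eq_square[symmetric] abs_square_eq_1 .
    qed
    ultimately show "?P ?h" by (intro suff lin)
  next
    fix m n :: 'n assume mn: "m \<noteq> n"
    let ?h = "\<lambda>x :: real^'n. \<chi> i. if i = m then x $ m + x $ n else x $ i"
    have lin: "linear ?h" by (rule linearI) (auto simp: vec_eq_iff algebra_simps)
    have "measure lebesgue (?h ` cbox a b) = measure lebesgue (cbox a b)" for a b
    proof (cases "cbox a b = {}")
      case False
      \<comment> \<open>Translating by v makes the box start at 0 in coordinate n, the position in
        which \<open>measure_shear_interval\<close> applies.\<close>
      define v where "v = (\<chi> i. if i = n then - a $ n else 0)"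
      have "?h ` cbox (v + a) (v + b) = (+) (?h v) ` ?h ` cbox a b"
        unfolding cbox_translation[of v] image_image by (simp add: linear_add[OF lin])
      then have "measure lebesgue (?h ` cbox a b) = measure lebesgue (?h ` cbox (v + a) (v + b))"
        by (simp only: measure_translation)
      also have "\<dots> = measure lebesgue (cbox (v + a) (v + b))"
        using False by (intro measure_shear_interval) (auto simp: mn cbox_translation v_def)
      also have "\<dots> = measure lebesgue (cbox a b)"
        unfolding cbox_translation[of v] by (rule measure_translation)
      finally show ?thesis by simp
    qed simp
    moreover have "matrix ?h = (\<chi> k. if k = m then row m (mat 1) + 1 *s row n (mat 1) else row k (mat 1))"
      by (auto simp: matrix_def row_def mat_def axis_def vec_eq_iff)
    then have "\<bar>det (matrix ?h)\<bar> = 1" using det_row_operation[OF mn, where A = "mat 1 :: real^'n^'n" and c = 1] by simp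
    ultimately show "?P ?h" by (intro suff lin)
  qed
  then show ?thesis using assms(2) by blast
qed

section \<open>The Gaussian reference measure and square integrable maps\<close>

lemma bij_betw_axis_Basis: "bij_betw (\<lambda>i::'n::finite. axis i (1::real)) UNIV Basis"
  by (auto simp: bij_betw_def inj_on_def axis_eq_axis Basis_vec_def)

text \<open>Tonelli in coordinates: the product formula over \<open>Basis\<close> is carried to the
  index type by the bijection from i to \<open>axis i 1\<close>.\<close>

lemma nn_integral_vec_prod:
  fixes f :: "'n::finite \<Rightarrow> real \<Rightarrow> ennreal"
  assumes f: "\<And>i. f i \<in> borel_measurable borel"
  shows "(\<integral>\<^sup>+ u. (\<Prod>i\<in>UNIV. f i (u $ i)) \<partial>(lborel :: (real^'n) measure)) = (\<Prod>i\<in>UNIV. \<integral>\<^sup>+ x. f i x \<partial>lborel)"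
proof -
  let ?ax = "\<lambda>i::'n. axis i (1::real)"
  let ?g = "\<lambda>b. f (inv ?ax b)"
  have inj: "inj ?ax" by (auto simp: inj_on_def axis_eq_axis)
  have "(\<Prod>i\<in>UNIV. f i (u $ i)) = (\<Prod>b\<in>Basis. ?g b (u \<bullet> b))" for u :: "real^'n"
    by (subst prod.reindex_bij_betw[OF bij_betw_axis_Basis, symmetric])
      (simp add: inv_f_f[OF inj] inner_axis)
  moreover have "(\<Prod>i\<in>UNIV. \<integral>\<^sup>+ x. f i x \<partial>lborel) = (\<Prod>b\<in>Basis. \<integral>\<^sup>+ x. ?g b x \<partial>lborel)"
    by (subst prod.reindex_bij_betw[OF bij_betw_axis_Basis, symmetric])
      (simp add: inv_f_f[OF inj])
  ultimately show ?thesis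
    using nn_integral_lborel_prod[of ?g] f by simp
qed

lemma space_gauss [simp]: "space gauss = UNIV" and sets_gauss [simp, measurable_cong]: "sets gauss = sets borel"
  by (simp_all add: gauss_def)

lemma nn_integral_gauss_prod:
  fixes f :: "'n::finite \<Rightarrow> real \<Rightarrow> real"
  assumes f [measurable]: "\<And>i. f i \<in> borel_measurable borel" and "\<And>i x. 0 \<le> f i x"
  shows "(\<integral>\<^sup>+ u. ennreal (\<Prod>i\<in>UNIV. f i (u $ i)) \<partial>(gauss :: (real^'n) measure))
    = (\<Prod>i\<in>UNIV. \<integral>\<^sup>+ x. ennreal (std_normal_density x * f i x) \<partial>lborel)"
  using assms(2) unfolding gauss_def
  by (subst nn_integral_density)
    (auto simp: prod_nonneg prod_ennreal simp flip: ennreal_mult prod.distrib nn_integral_vec_prod)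

lemma nn_integral_std_normal_density: "(\<integral>\<^sup>+ x. ennreal (std_normal_density x) \<partial>lborel) = 1"
  using prob_space.emeasure_space_1[OF prob_space_normal_density[of 1 0]]
  by (simp add: emeasure_density)

lemma prob_space_gauss: "prob_space (gauss :: (real^'n) measure)"
proof
  show "emeasure gauss (space (gauss :: (real^'n) measure)) = 1"
    using nn_integral_gauss_prod[of "\<lambda>(i::'n) x. 1"]
    by (simp add: nn_integral_std_normal_density)
qed

text \<open>One squared coordinate is a product whose other factors are 1, so its integral factors
  into one-dimensional normal moments; the squared norm is a finite sum of these.\<close>

lemma integrable_gauss_norm_square: "integrable (gauss :: (real^'n) measure) (\<lambda>u. (norm u)\<^sup>2)"
proof -
  have "integrable (gauss :: (real^'n) measure) (\<lambda>u. (u $ j)\<^sup>2)" for j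
  proof (rule integrableI_bounded)
    let ?f = "\<lambda>i x. if i = j then x\<^sup>2 else (1::real)"
    have eq: "(u $ j)\<^sup>2 = (\<Prod>i\<in>UNIV. ?f i (u $ i))" for u :: "real^'n"
      by simp
    have "integrable lborel (\<lambda>x. std_normal_density x * x\<^sup>2)"
      using integrable_std_normal_moment[of 2] by simp
    then have 1: "(\<integral>\<^sup>+ x. ennreal (std_normal_density x * x\<^sup>2) \<partial>lborel) < \<infinity>"
      by (subst (asm) integrable_iff_bounded) auto
    have 2: "(\<integral>\<^sup>+ x. ennreal (std_normal_density x * ?f i x) \<partial>lborel) < \<infinity>" for i
      using 1 by (cases "i = j") (auto simp: nn_integral_std_normal_density)
    have "(\<integral>\<^sup>+ u. ennreal (norm ((u $ j)\<^sup>2)) \<partial>(gauss :: (real^'n) measure))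
        = (\<Prod>i\<in>UNIV. \<integral>\<^sup>+ x. ennreal (std_normal_density x * ?f i x) \<partial>lborel)"
      unfolding eq by (subst nn_integral_gauss_prod[symmetric]) (auto simp: prod_nonneg abs_prod)
    also have "\<dots> < \<infinity>"
      using 2 by (force simp: less_top[symmetric] ennreal_prod_eq_top)
    finally show "(\<integral>\<^sup>+ u. ennreal (norm ((u $ j)\<^sup>2)) \<partial>(gauss :: (real^'n) measure)) < \<infinity>" .
  qed simp
  then show ?thesis
    by (simp add: power2_norm_eq_inner inner_vec_def flip: power2_eq_square)
qed

interpretation gauss: prob_space "gauss :: (real^'n) measure"
  by (rule prob_space_gauss)

lemma sq_mapsD:
  fixes F :: "real^'n \<Rightarrow> real^'n"
  assumes "F \<in> sq_maps"
  shows sq_maps_measurable: "F \<in> borel_measurable borel"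
    and sq_maps_norm_square: "integrable gauss (\<lambda>u. (norm (F u))\<^sup>2)"
    and sq_maps_norm: "integrable gauss (\<lambda>u. norm (F u))"
    and sq_maps_integrable: "integrable gauss F"
proof -
  show [measurable]: "F \<in> borel_measurable borel" 
    and 2: "integrable gauss (\<lambda>u. (norm (F u))\<^sup>2)"
    using assms by (auto simp: sq_maps_def)
  \<comment> \<open>On a probability space the second moment controls the first.\<close>
  have "norm (F u) \<le> 1 + (norm (F u))\<^sup>2" for u
  proof -
    have "2 * norm (F u) \<le> (norm (F u))\<^sup>2 + 1"
      using sum_squares_bound[of "norm (F u)" 1] by simp
    then show ?thesis using norm_ge_zero[of "F u"] by linarith
  qed
  then have "AE u in gauss. norm (F u) \<le> norm (1 + (norm (F u))\<^sup>2)" by (intro AE_I2) simp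
  moreover have "integrable gauss (\<lambda>u. 1 + (norm (F u))\<^sup>2)"
    by (intro Bochner_Integration.integrable_add gauss.integrable_const 2)
  moreover have "F \<in> borel_measurable gauss" by simp
  ultimately show "integrable gauss F"
    using Bochner_Integration.integrable_bound by blast
  then show "integrable gauss (\<lambda>u. norm (F u))" by (rule integrable_norm)
qed

lemma sq_maps_affine: "(\<lambda>u. m + R *v u) \<in> sq_maps" for R :: "real^'n^'n"
proof -
  obtain K where K: "norm (R *v u) \<le> norm u * K" for u
    using bounded_linear.bounded[OF matrix_vector_mul_bounded_linear] by blast
  have meas: "(\<lambda>u. m + R *v u) \<in> borel_measurable borel"
    by (intro borel_measurable_continuous_onI continuous_intros matrix_vector_mult_linear_continuous_on)
  have "integrable gauss (\<lambda>u. (norm (m + R *v u))\<^sup>2)"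
  proof (rule Bochner_Integration.integrable_bound)
    show "integrable (gauss :: (real^'n) measure) (\<lambda>u. 2 * (norm m)\<^sup>2 + 2 * K\<^sup>2 * (norm u)\<^sup>2)"
      by (intro Bochner_Integration.integrable_add gauss.integrable_const
          Bochner_Integration.integrable_mult_right integrable_gauss_norm_square)
    show "(\<lambda>u. (norm (m + R *v u))\<^sup>2) \<in> borel_measurable gauss"
      using meas by measurable
    show "AE u in gauss. norm ((norm (m + R *v u))\<^sup>2) \<le> norm (2 * (norm m)\<^sup>2 + 2 * K\<^sup>2 * (norm u)\<^sup>2)"
    proof (intro AE_I2)
      fix u :: "real^'n"
      have "(norm (m + R *v u))\<^sup>2 \<le> (norm m + norm u * K)\<^sup>2"
        using K[of u] norm_triangle_ineq[of m "R *v u"] by (intro power_mono norm_ge_zero) linarith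
      also have "\<dots> \<le> 2 * (norm m)\<^sup>2 + 2 * K\<^sup>2 * (norm u)\<^sup>2"
        using sum_squares_bound[of "norm m" "norm u * K"]
        by (simp add: power2_sum power_mult_distrib mult_ac)
      finally show "norm ((norm (m + R *v u))\<^sup>2) \<le> norm (2 * (norm m)\<^sup>2 + 2 * K\<^sup>2 * (norm u)\<^sup>2)"
        by simp
    qed
  qed
  then show ?thesis using meas by (simp add: sq_maps_def)
qed

section \<open>Second moments and quadratic forms\<close>

lemma trace_matrix_mul_outer: "trace (A ** outer u w) = w \<bullet> (A *v u)"
  by (simp add: trace_def matrix_matrix_mult_def outer_def inner_vec_def matrix_vector_mult_def
      sum_distrib_left mult_ac)

lemma norm_outer: "norm (outer u w) = norm u * norm w"
proof -
  have "outer u w = (\<chi> i. (u $ i) *\<^sub>R w)" by (simp add: outer_def vec_eq_iff)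
  then show ?thesis
    by (simp add: norm_vec_def[of "_ :: real^'b^'a"] norm_vec_def[of u] L2_set_left_distrib)
qed

lemma outer_measurable [measurable]:
  assumes "f \<in> borel_measurable M"
  shows "(\<lambda>u. outer (f u) (f u) :: real^'n^'n) \<in> borel_measurable M"
proof -
  have "continuous_on UNIV (\<lambda>x :: real^'n. outer x x)"
    unfolding outer_def by (intro continuous_intros)
  then show ?thesis using assms borel_measurable_continuous_on by blast
qed

lemma bounded_linear_trace_mul: "bounded_linear (\<lambda>X :: real^'n^'n. trace (A ** X))"
  unfolding linear_conv_bounded_linear[symmetric]
  by (rule linearI)
    (simp_all add: trace_def matrix_add_ldistrib matrix_matrix_mult_def sum_distrib_left sum.distrib
      algebra_simps)

lemma sq_maps_diff:
  fixes F :: "real^'n \<Rightarrow> real^'n"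
  assumes F: "F \<in> sq_maps"
  shows "(\<lambda>u. F u - m) \<in> sq_maps"
proof -
  note [measurable] = sq_mapsD(1)[OF F]
  have "integrable gauss (\<lambda>u. (norm (F u - m))\<^sup>2)"
  proof (rule Bochner_Integration.integrable_bound)
    show "integrable gauss (\<lambda>u. 2 * (norm (F u))\<^sup>2 + 2 * (norm m)\<^sup>2)"
      by (intro Bochner_Integration.integrable_add gauss.integrable_const
          Bochner_Integration.integrable_mult_right sq_mapsD(2)[OF F])
    have "(norm (F u - m))\<^sup>2 \<le> 2 * (norm (F u))\<^sup>2 + 2 * (norm m)\<^sup>2" for u
    proof -
      have "(norm (F u - m))\<^sup>2 \<le> (norm (F u) + norm m)\<^sup>2"
        by (intro power_mono norm_ge_zero norm_triangle_ineq4)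
      then show ?thesis
        using sum_squares_bound[of "norm (F u)" "norm m"] by (simp add: power2_sum)
    qed
    then show "AE u in gauss. norm ((norm (F u - m))\<^sup>2) \<le> norm (2 * (norm (F u))\<^sup>2 + 2 * (norm m)\<^sup>2)"
      by simp
  qed simp
  then show ?thesis by (simp add: sq_maps_def)
qed

lemma integrable_outer:
  fixes F :: "real^'n \<Rightarrow> real^'n"
  assumes F: "F \<in> sq_maps"
  shows "integrable gauss (\<lambda>u. outer (F u) (F u))"
proof -
  note [measurable] = sq_mapsD(1)[OF F]
  show ?thesis
    by (intro Bochner_Integration.integrable_bound[OF sq_mapsD(2)[OF F]])
      (auto simp: norm_outer power2_eq_square)
qed

lemma integrable_quadratic_form:
  fixes F :: "real^'n \<Rightarrow> real^'n"
  assumes F: "F \<in> sq_maps"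
  shows "integrable gauss (\<lambda>u. F u \<bullet> (A *v F u))"
  using integrable_bounded_linear[OF bounded_linear_trace_mul integrable_outer[OF F]]
  by (simp add: trace_matrix_mul_outer)

text \<open>\<open>A\<close> is an arbitrary matrix here, so the two cross terms stay separate until
  symmetry is available.\<close>

lemma integral_quadratic_form_shift:
  fixes F :: "real^'n \<Rightarrow> real^'n"
  assumes F: "F \<in> sq_maps"
  shows "(\<integral>u. (F u - k) \<bullet> (A *v (F u - k)) \<partial>gauss)
    = (\<integral>u. F u \<bullet> (A *v F u) \<partial>gauss) - mean_map F \<bullet> (A *v k) - k \<bullet> (A *v mean_map F) + k \<bullet> (A *v k)"
proof -
  define L where "L x = x \<bullet> (A *v k) + k \<bullet> (A *v x)" for x
  have L: "bounded_linear L"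
    unfolding linear_conv_bounded_linear[symmetric] L_def
    by (rule linearI) (simp_all add: inner_add_left matrix_vector_right_distrib inner_add_right
        matrix_vector_mult_scaleR algebra_simps)
  note int = integrable_bounded_linear[OF L sq_mapsD(4)[OF F]] integrable_quadratic_form[OF F]
  have "(\<integral>u. (F u - k) \<bullet> (A *v (F u - k)) \<partial>gauss)
    = (\<integral>u. F u \<bullet> (A *v F u) - L (F u) + k \<bullet> (A *v k) \<partial>gauss)"
    by (intro Bochner_Integration.integral_cong refl)
      (simp add: L_def matrix_vector_mult_diff_distrib inner_diff_left inner_diff_right)
  also have "\<dots> = (\<integral>u. F u \<bullet> (A *v F u) \<partial>gauss) - (\<integral>u. L (F u) \<partial>gauss) + k \<bullet> (A *v k)"
    using int by (simp add: gauss.prob_space[simplified])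
  also have "(\<integral>u. L (F u) \<partial>gauss) = L (mean_map F)"
    unfolding mean_map_def by (rule integral_bounded_linear[OF L sq_mapsD(4)[OF F]])
  finally show ?thesis by (simp add: L_def)
qed

text \<open>The second moment splits into mean and covariance. This removes \<open>cov_map\<close>
  from the Hamiltonian, whose diffusion term becomes an expectation of the same kind as the jump
  term.\<close>

lemma mean_cov_quadratic_form:
  fixes F :: "real^'n \<Rightarrow> real^'n"
  assumes F: "F \<in> sq_maps"
  shows "mean_map F \<bullet> (A *v mean_map F) + trace (A ** cov_map F) = (\<integral>u. F u \<bullet> (A *v F u) \<partial>gauss)"
proof -
  have "trace (A ** cov_map F) = (\<integral>u. (F u - mean_map F) \<bullet> (A *v (F u - mean_map F)) \<partial>gauss)"
    unfolding cov_map_def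
    using integral_bounded_linear[OF bounded_linear_trace_mul integrable_outer[OF sq_maps_diff[OF F]], symmetric]
    by (simp add: trace_matrix_mul_outer)
  then show ?thesis using integral_quadratic_form_shift[OF F, of "mean_map F" A] by simp
qed

section \<open>Affine images of Lebesgue and Gaussian measure\<close>

text \<open>Lebesgue measure is determined by its values on boxes. The preimage of a box is Q
  applied to a translated box, with Q the inverse of R, so its volume carries the factor |det Q| = 1
  / |det R|.\<close>

lemma lborel_affine_vec:
  fixes R :: "real^'n^'n"
  assumes R: "invertible R"
  shows "distr lborel lborel (\<lambda>u. m + R *v u) = density lborel (\<lambda>_. ennreal (1 / \<bar>det R\<bar>))"
proof -
  let ?f = "\<lambda>u. m + R *v u"
  obtain Q where Q: "R ** Q = mat 1" "Q ** R = mat 1" using R invertible_def by blast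
  have det: "det R * det Q = 1" using Q(1) by (metis det_I det_mul)
  have f [measurable]: "?f \<in> borel_measurable borel"
    by (intro borel_measurable_continuous_onI continuous_intros matrix_vector_mult_linear_continuous_on)
  \<comment> \<open>The uniqueness criterion \<open>lborel_eqI\<close> characterizes
    \<open>lborel\<close> itself, so the factor |det R| is first put on the image measure and
    divided out at the end.\<close>
  have "lborel = density (distr lborel lborel ?f) (\<lambda>_. ennreal \<bar>det R\<bar>)"
  proof (rule lborel_eqI)
    fix l u :: "real^'n" assume le: "\<And>b. b \<in> Basis \<Longrightarrow> l \<bullet> b \<le> u \<bullet> b"
    have pre: "?f -` box l u = (*v) Q ` box (l - m) (u - m)"
    proof safe
      fix x assume "m + R *v x \<in> box l u"
      then have "R *v x \<in> box (l - m) (u - m)" by (auto simp: mem_box algebra_simps)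
      moreover have "x = Q *v (R *v x)" by (simp add: matrix_vector_mul_assoc Q)
      ultimately show "x \<in> (*v) Q ` box (l - m) (u - m)" by blast
    next
      fix x assume "x \<in> box (l - m) (u - m)"
      then show "Q *v x \<in> ?f -` box l u"
        by (auto simp: mem_box algebra_simps matrix_vector_mul_assoc Q)
    qed
    have "(*v) Q ` box (l - m) (u - m) \<in> lmeasurable"
      using measure_linear_image_vec[OF matrix_vector_mul_linear lmeasurable_box] by blast
    then have "emeasure lebesgue (?f -` box l u) = ennreal (\<bar>det Q\<bar> * measure lebesgue (box (l - m) (u - m)))"
      using measure_linear_image_vec[OF matrix_vector_mul_linear lmeasurable_box, of Q]
      unfolding pre by (simp add: emeasure_eq_measure2)
    also have "measure lebesgue (box (l - m) (u - m)) = (\<Prod>b\<in>Basis. (u - l) \<bullet> b)"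
      using le by (simp add: measure_lborel_box_eq inner_diff_left)
    finally have "emeasure lborel (?f -` box l u) = ennreal (\<bar>det Q\<bar> * (\<Prod>b\<in>Basis. (u - l) \<bullet> b))"
      using measurable_sets[OF f, of "box l u"] by simp
    then have "emeasure (density (distr lborel lborel ?f) (\<lambda>_. ennreal \<bar>det R\<bar>)) (box l u)
        = ennreal \<bar>det R\<bar> * ennreal (\<bar>det Q\<bar> * (\<Prod>b\<in>Basis. (u - l) \<bullet> b))"
      by (simp add: emeasure_density_const emeasure_distr)
    also have "\<dots> = ennreal (\<Prod>b\<in>Basis. (u - l) \<bullet> b)"
      using det by (simp add: abs_mult[symmetric] mult.assoc[symmetric] flip: ennreal_mult')
    finally show "emeasure (density (distr lborel lborel ?f) (\<lambda>_. ennreal \<bar>det R\<bar>)) (box l u)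
        = (\<Prod>b\<in>Basis. (u - l) \<bullet> b)" by simp
  qed simp
  then have "density lborel (\<lambda>_. ennreal (1 / \<bar>det R\<bar>))
      = density (density (distr lborel lborel ?f) (\<lambda>_. ennreal \<bar>det R\<bar>)) (\<lambda>_. ennreal (1 / \<bar>det R\<bar>))"
    by simp
  also have "\<dots> = density (distr lborel lborel ?f) (\<lambda>_. 1)"
    using det by (subst density_density_eq) (auto simp flip: ennreal_mult')
  finally show ?thesis by (simp add: density_1)
qed

text \<open>The Gaussian density is rewritten as h composed with the affine map; it then passes
  through the image measure unchanged, and only the Jacobian factor is added.\<close>

lemma gauss_affine:
  fixes R :: "real^'n^'n"
  assumes R: "invertible R"
  shows "distr gauss lborel (\<lambda>u. m + R *v u) = density lborel (\<lambda>z.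
    ennreal ((\<Prod>i\<in>UNIV. std_normal_density ((matrix_inv R *v (z - m)) $ i)) / \<bar>det R\<bar>))"
proof -
  let ?f = "\<lambda>u. m + R *v u"
  define g where "g u = (\<Prod>i\<in>UNIV. std_normal_density (u $ i))" for u :: "real^'n"
  define h where "h z = ennreal (g (matrix_inv R *v (z - m)))" for z
  have inv: "matrix_inv R *v (R *v u) = u" for u
    using R someI_ex[of "\<lambda>A'. R ** A' = mat 1 \<and> A' ** R = mat 1"]
    by (simp add: matrix_vector_mul_assoc invertible_def matrix_inv_def)
  have meas1: "(\<lambda>z. matrix_inv R *v (z - m)) \<in> borel_measurable borel"
    unfolding matrix_vector_mult_diff_distrib
    by (intro borel_measurable_continuous_onI continuous_intros matrix_vector_mult_linear_continuous_on)
  have meas2: "?f \<in> borel_measurable borel"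
    by (intro borel_measurable_continuous_onI continuous_intros matrix_vector_mult_linear_continuous_on)
  have g: "g \<in> borel_measurable borel" unfolding g_def by measurable
  have h: "h \<in> borel_measurable borel"
    unfolding h_def using measurable_compose[OF meas1 g] by measurable
  have "distr gauss lborel ?f = distr (density lborel (\<lambda>u. h (?f u))) lborel ?f"
    by (simp add: gauss_def h_def inv g_def)
  also have "\<dots> = density (distr lborel lborel ?f) h"
    using h meas2 by (intro density_distr[symmetric]) auto
  also have "\<dots> = density lborel (\<lambda>z. ennreal (1 / \<bar>det R\<bar>) * h z)"
    unfolding lborel_affine_vec[OF R] using h by (subst density_density_eq) auto
  also have "\<dots> = density lborel (\<lambda>z. ennreal (g (matrix_inv R *v (z - m)) / \<bar>det R\<bar>))"
    by (simp add: h_def flip: ennreal_mult')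
  finally show ?thesis by (simp add: g_def)
qed

section \<open>Differential entropy\<close>

text \<open>Membership in \<open>class_A\<close> makes the law of F absolutely continuous, so its
  Radon-Nikodym derivative is a density. The law is a finite measure, hence the derivative is finite
  almost everywhere and \<open>enn2real\<close> in \<open>map_density\<close> loses nothing.\<close>

lemma map_density_law:
  fixes F :: "real^'n \<Rightarrow> real^'n"
  assumes F: "F \<in> class_A"
  shows map_density_measurable: "map_density F \<in> borel_measurable borel"
    and density_map_density: "density lborel (\<lambda>z. ennreal (map_density F z)) = distr gauss lborel F"
    and integrable_map_density: "g \<in> borel_measurable borel \<Longrightarrow>
      integrable lborel (\<lambda>z. map_density F z * g z) \<longleftrightarrow> integrable gauss (\<lambda>u. g (F u))"
    and integral_map_density: "g \<in> borel_measurable borel \<Longrightarrow>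
      (\<integral>z. map_density F z * g z \<partial>lborel) = (\<integral>u. g (F u) \<partial>gauss)"
proof -
  let ?N = "distr gauss lborel F"
  obtain p where p: "distributed gauss lborel F p" using F by (auto simp: class_A_def)
  have meas: "F \<in> borel_measurable borel" using F by (auto simp: class_A_def sq_maps_def)
  have F' [measurable]: "F \<in> measurable gauss lborel" using meas by simp
  interpret N: prob_space ?N by (rule gauss.prob_space_distr) fact
  have ac: "absolutely_continuous lborel ?N" "sets ?N = sets lborel"
    using p by (auto simp: distributed_def intro: absolutely_continuousI_density)
  have sf: "sigma_finite_measure ?N" by unfold_locales
  show pm [measurable]: "map_density F \<in> borel_measurable borel"
    unfolding map_density_def by measurable
  have "density lborel (\<lambda>z. ennreal (map_density F z)) = density lborel (RN_deriv lborel ?N)"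
    using sigma_finite_measure.RN_deriv_finite[OF sigma_finite_lborel sf ac]
    by (intro density_cong) (auto simp: map_density_def less_top)
  then show "density lborel (\<lambda>z. ennreal (map_density F z)) = ?N"
    using sigma_finite_measure.density_RN_deriv[OF sigma_finite_lborel ac] by simp
  fix g :: "real^'n \<Rightarrow> real" assume g: "g \<in> borel_measurable borel"
  show "integrable lborel (\<lambda>z. map_density F z * g z) \<longleftrightarrow> integrable gauss (\<lambda>u. g (F u))"
    using sigma_finite_measure.RN_deriv_integrable[OF sigma_finite_lborel sf ac, of g] g
    by (simp add: map_density_def integrable_distr_eq[OF F'])
  show "(\<integral>z. map_density F z * g z \<partial>lborel) = (\<integral>u. g (F u) \<partial>gauss)"
    using sigma_finite_measure.RN_deriv_integral[OF sigma_finite_lborel sf ac, of g] g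
    by (simp add: map_density_def integral_distr[OF F'])
qed

lemma map_density_nonneg: "0 \<le> map_density F z"
  by (simp add: map_density_def)

lemma Ent_integrable:
  assumes "integrable lborel (\<lambda>z. map_density F z * ln (map_density F z))"
  shows "Ent F = ereal (- (\<integral>z. map_density F z * ln (map_density F z) \<partial>lborel))"
proof -
  obtain r s where rs: "0 \<le> r" "0 \<le> s"
    "(\<integral>\<^sup>+ z. ennreal (map_density F z * ln (map_density F z)) \<partial>lborel) = ennreal r"
    "(\<integral>\<^sup>+ z. ennreal (- (map_density F z * ln (map_density F z))) \<partial>lborel) = ennreal s"
    "(\<integral>z. map_density F z * ln (map_density F z) \<partial>lborel) = r - s"
    using assms by (rule integrableE)
  then show ?thesis by (simp add: Ent_def enn2ereal_ennreal)
qed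

text \<open>Gibbs' inequality from ln x \<le> x - 1 at x = q/p. The resulting majorant w of - p ln p
  is integrable, and its integral is the cross entropy because p and q both have mass 1;
  integrability of p ln p itself is not presupposed.\<close>

lemma Ent_le_cross_entropy:
  fixes F :: "real^'n \<Rightarrow> real^'n"
  assumes F: "F \<in> class_A" and q [measurable]: "q \<in> borel_measurable borel" and pos: "\<And>z. 0 < q z"
    and one: "(\<integral>\<^sup>+ z. ennreal (q z) \<partial>lborel) = 1"
    and int: "integrable gauss (\<lambda>u. ln (q (F u)))"
  shows "Ent F \<le> ereal (- (\<integral>u. ln (q (F u)) \<partial>gauss))"
proof -
  define p where "p = map_density F"
  note [measurable] = map_density_measurable[OF F, folded p_def]
  have p0: "0 \<le> p z" for z by (simp add: p_def map_density_nonneg)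
  have lnq: "(\<lambda>z. ln (q z)) \<in> borel_measurable borel" by measurable
  have ip: "integrable lborel p" "(\<integral>z. p z \<partial>lborel) = 1"
    using integrable_map_density[OF F, of "\<lambda>_. 1"] integral_map_density[OF F, of "\<lambda>_. 1"]
    by (simp_all add: p_def gauss.prob_space[simplified])
  have iq: "integrable lborel q" "(\<integral>z. q z \<partial>lborel) = 1"
    using one pos by (auto simp: less_imp_le integrable_iff_bounded integral_eq_nn_integral)
  have ipq: "integrable lborel (\<lambda>z. p z * ln (q z))"
    "(\<integral>z. p z * ln (q z) \<partial>lborel) = (\<integral>u. ln (q (F u)) \<partial>gauss)"
    using integrable_map_density[OF F lnq] integral_map_density[OF F lnq] int by (simp_all add: p_def)
  define w where "w z = - (p z * ln (q z)) + q z - p z" for z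
  have iw: "integrable lborel w" "(\<integral>z. w z \<partial>lborel) = - (\<integral>u. ln (q (F u)) \<partial>gauss)"
    unfolding w_def using ip iq ipq by simp_all
  \<comment> \<open>The summand q - p makes the bound hold pointwise; where p vanishes it reduces to
    0 \<le> q.\<close>
  have le: "- (p z * ln (p z)) \<le> w z" for z
  proof (cases "p z = 0")
    case False
    then have pz: "0 < p z" using p0[of z] by simp
    have "p z * ln (q z / p z) \<le> p z * (q z / p z - 1)"
      using pz pos[of z] by (intro mult_left_mono ln_le_minus_one) auto
    then show ?thesis using pz pos[of z] by (simp add: w_def ln_div algebra_simps)
  qed (use pos[of z] in \<open>simp add: w_def less_imp_le\<close>)
  show ?thesis
  proof (cases "integrable lborel (\<lambda>z. p z * ln (p z))")
    case True
    then have "- (\<integral>z. p z * ln (p z) \<partial>lborel) \<le> (\<integral>z. w z \<partial>lborel)"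
      using integral_mono[OF _ iw(1) le] by simp
    then show ?thesis using Ent_integrable[of F] True iw(2) by (simp add: p_def)
  next
    \<comment> \<open>The majorant keeps the positive part of - p ln p finite, so nonintegrability
      makes the negative part infinite and the entropy is -infinity.\<close>
    case False
    have "(\<integral>\<^sup>+ z. ennreal (- (p z * ln (p z))) \<partial>lborel) \<le> (\<integral>\<^sup>+ z. ennreal (w z) \<partial>lborel)"
      using le by (intro nn_integral_mono ennreal_leI)
    also have "\<dots> < \<infinity>" using iw(1) by (simp add: real_integrable_def less_top)
    finally have fin: "(\<integral>\<^sup>+ z. ennreal (- (p z * ln (p z))) \<partial>lborel) \<noteq> \<infinity>" by simp
    then have inf: "(\<integral>\<^sup>+ z. ennreal (p z * ln (p z)) \<partial>lborel) = \<infinity>"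
      using False by (simp add: real_integrable_def)
    have "enn2ereal (\<integral>\<^sup>+ z. ennreal (- (p z * ln (p z))) \<partial>lborel) \<noteq> \<infinity>"
      using fin by (simp add: enn2ereal_eq_top_iff)
    then have "Ent F = - \<infinity>"
      unfolding Ent_def p_def[symmetric] inf by (cases "enn2ereal (\<integral>\<^sup>+ z. ennreal (- (p z * ln (p z))) \<partial>lborel)") (auto simp: top_ereal_def)
    then show ?thesis by simp
  qed
qed

text \<open>The equality case: p and q are densities of the same law and therefore agree almost
  everywhere.\<close>

lemma Ent_eq_cross_entropy:
  fixes F :: "real^'n \<Rightarrow> real^'n"
  assumes F: "F \<in> class_A" and q [measurable]: "q \<in> borel_measurable borel" and pos: "\<And>z. 0 < q z"
    and law: "distr gauss lborel F = density lborel (\<lambda>z. ennreal (q z))"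
    and int: "integrable gauss (\<lambda>u. ln (q (F u)))"
  shows "Ent F = ereal (- (\<integral>u. ln (q (F u)) \<partial>gauss))"
proof -
  define p where "p = map_density F"
  note pm [measurable] = map_density_measurable[OF F, folded p_def]
  have p0: "0 \<le> p z" for z by (simp add: p_def map_density_nonneg)
  have lnq: "(\<lambda>z. ln (q z)) \<in> borel_measurable borel" by measurable
  have "density lborel (\<lambda>z. ennreal (p z)) = density lborel (\<lambda>z. ennreal (q z))"
    using density_map_density[OF F] law by (simp add: p_def)
  then have "AE z in lborel. ennreal (p z) = ennreal (q z)"
    by (intro sigma_finite_measure.density_unique_iff[OF sigma_finite_lborel, THEN iffD1]) auto
  then have ae: "AE z in lborel. p z * ln (p z) = p z * ln (q z)"
    using p0 pos by (auto simp: less_imp_le)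
  have ipq: "integrable lborel (\<lambda>z. p z * ln (q z))"
    "(\<integral>z. p z * ln (q z) \<partial>lborel) = (\<integral>u. ln (q (F u)) \<partial>gauss)"
    using integrable_map_density[OF F lnq] integral_map_density[OF F lnq] int by (simp_all add: p_def)
  have "integrable lborel (\<lambda>z. p z * ln (p z))"
    using ipq(1) integrable_cong_AE[OF _ _ ae] by simp
  moreover have "(\<integral>z. p z * ln (p z) \<partial>lborel) = (\<integral>u. ln (q (F u)) \<partial>gauss)"
    using ipq(2) integral_cong_AE[OF _ _ ae] by simp
  ultimately show ?thesis using Ent_integrable[of F] by (simp add: p_def)
qed

section \<open>Entropy against quadratic cost\<close>

lemma det_scaleR: "det (c *\<^sub>R A) = c ^ CARD('n) * det A" for A :: "real^'n^'n"
proof -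
  have "c *\<^sub>R A = (\<chi> i. c *s (A $ i))" by (simp add: vec_eq_iff)
  then show ?thesis using det_rows_mul[of "\<lambda>_. c" "\<lambda>i. A $ i"] by simp
qed

lemma std_normal_density_prod_measurable:
  fixes Q :: "real^'n^'n"
  shows "(\<lambda>z. \<Prod>i\<in>UNIV. std_normal_density ((Q *v (z - m)) $ i)) \<in> borel_measurable borel"
proof -
  have "(\<lambda>z. Q *v (z - m)) \<in> borel_measurable borel"
    unfolding matrix_vector_mult_diff_distrib
    by (intro borel_measurable_continuous_onI continuous_intros matrix_vector_mult_linear_continuous_on)
  moreover have "(\<lambda>u :: real^'n. \<Prod>i\<in>UNIV. std_normal_density (u $ i)) \<in> borel_measurable borel"
    by measurable
  ultimately show ?thesis by (rule measurable_compose)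
qed

lemma affine_class_A:
  fixes R :: "real^'n^'n"
  assumes R: "invertible R"
  shows "(\<lambda>u. m + R *v u) \<in> class_A"
proof -
  have "(\<lambda>u. m + R *v u) \<in> borel_measurable borel" using sq_maps_affine sq_mapsD(1) by blast
  moreover have "(\<lambda>z. ennreal ((\<Prod>i\<in>UNIV. std_normal_density ((matrix_inv R *v (z - m)) $ i)) / \<bar>det R\<bar>))
      \<in> borel_measurable borel"
    using std_normal_density_prod_measurable[of "matrix_inv R" m] by measurable
  ultimately have "distributed gauss lborel (\<lambda>u. m + R *v u) (\<lambda>z.
    ennreal ((\<Prod>i\<in>UNIV. std_normal_density ((matrix_inv R *v (z - m)) $ i)) / \<bar>det R\<bar>))"
    unfolding distributed_def using gauss_affine[OF R, of m] by auto
  then show ?thesis using sq_maps_affine unfolding class_A_def by blast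
qed

text \<open>Gibbs' inequality with the Gaussian of mean \<open>m\<close> and covariance \<open>lam / 2 S\<^sup>-\<^sup>1\<close> as reference:
  the logarithm of its density is the quadratic cost up to a constant.\<close>

lemma entropy_quadratic_bound:
  fixes S :: "real^'n^'n" and m :: "real^'n"
  assumes S: "pos_def S" and lam: "0 < lam"
  defines "R \<equiv> mat_sqrt ((lam / 2) *\<^sub>R matrix_inv S)"
  defines "cost \<equiv> \<lambda>F :: real^'n \<Rightarrow> real^'n. \<integral>u. (F u - m) \<bullet> (S *v (F u - m)) \<partial>gauss"
  defines "K \<equiv> lam / 2 * ln ((lam * pi) ^ CARD('n) / det S)"
  shows "F \<in> class_A \<Longrightarrow> ereal lam * Ent F \<le> ereal (K + cost F)"
    and "(\<lambda>u. m + R *v u) \<in> class_A"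
    and "ereal lam * Ent (\<lambda>u. m + R *v u) = ereal (K + cost (\<lambda>u. m + R *v u))"
proof -
  note invS = pos_def_invertible[OF S]
  have "pos_semidef ((lam / 2) *\<^sub>R matrix_inv S)"
    using pos_def_matrix_inv[OF S] lam by (intro pos_def_imp_pos_semidef pos_def_scaleR) auto
  then have psd: "pos_semidef R" and RR: "R ** R = (lam / 2) *\<^sub>R matrix_inv S"
    unfolding R_def by (auto intro: pos_semidef_mat_sqrt mat_sqrt_square)
  have "det (matrix_inv S) * det S = 1" using invS(1) by (metis det_I det_mul)
  \<comment> \<open>Only the square R R is known explicitly, so det R enters through its square and
    ln |det R| is recovered as half a logarithm.\<close>
  then have detR: "(det R)\<^sup>2 = (lam / 2) ^ CARD('n) / det S"
    using invS(3) RR by (metis det_mul det_scaleR power2_eq_square divide_inverse inverse_unique mult.commute)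
  then have detR0: "det R \<noteq> 0" using invS(3) lam by auto
  then have invR: "invertible R" by (simp add: invertible_det_nz)
  define Q where "Q = matrix_inv R"
  have RQ: "R ** Q = mat 1"
    using invR someI_ex[of "\<lambda>A'. R ** A' = mat 1 \<and> A' ** R = mat 1"]
    by (simp add: Q_def invertible_def matrix_inv_def)
  define q where "q z = (\<Prod>i\<in>UNIV. std_normal_density ((Q *v (z - m)) $ i)) / \<bar>det R\<bar>" for z
  have qpos: "0 < q z" for z
    unfolding q_def using detR0 by (intro divide_pos_pos prod_pos) (auto intro: normal_density_pos)
  have qm [measurable]: "q \<in> borel_measurable borel"
    unfolding q_def using std_normal_density_prod_measurable[of Q m] by measurable
  have law: "distr gauss lborel (\<lambda>u. m + R *v u) = density lborel (\<lambda>z. ennreal (q z))"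
    unfolding q_def Q_def by (rule gauss_affine[OF invR])
  have "prob_space (distr gauss lborel (\<lambda>u. m + R *v u))"
    using sq_mapsD(1)[OF sq_maps_affine[of m R]] by (intro gauss.prob_space_distr) simp
  \<comment> \<open>The mass of q is read off from the law it is a density of, so no Gaussian
    integral has to be evaluated.\<close>
  then have one: "(\<integral>\<^sup>+ z. ennreal (q z) \<partial>lborel) = 1"
    unfolding law using prob_space.emeasure_space_1 by (fastforce simp: emeasure_density)
  \<comment> \<open>The precision matrix of the reference law is (R R)^-1 = (2 / lam) S.\<close>
  have quad: "(Q *v x) \<bullet> (Q *v x) = 2 / lam * (x \<bullet> (S *v x))" for x
  proof -
    have tR: "transpose R = R" using psd by (simp add: pos_semidef_def)
    define y where "y = Q *v (Q *v x)"
    have R1: "R *v (Q *v z) = z" for z by (simp add: matrix_vector_mul_assoc RQ)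
    have Ry: "R *v (R *v y) = x" by (simp add: y_def R1)
    then have "(lam / 2) *\<^sub>R (matrix_inv S *v y) = x"
      by (simp add: matrix_vector_mul_assoc RR scaleR_matrix_vector_assoc)
    then have "S *v ((lam / 2) *\<^sub>R (matrix_inv S *v y)) = S *v x" by simp
    then have "(lam / 2) *\<^sub>R y = S *v x"
      by (simp add: matrix_vector_mult_scaleR matrix_vector_mul_assoc invS)
    then have "2 / lam * (x \<bullet> (S *v x)) = x \<bullet> y"
      using lam by (simp flip: \<open>(lam / 2) *\<^sub>R y = S *v x\<close>)
    also have "\<dots> = (R *v (Q *v x)) \<bullet> y" by (simp add: R1)
    also have "\<dots> = (Q *v x) \<bullet> (R *v y)" by (rule symmetric_inner[OF tR])
    also have "R *v y = Q *v x" by (simp add: y_def R1)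
    finally show ?thesis by simp
  qed
  \<comment> \<open>Besides the quadratic term, - ln q consists of D/2 ln(2 pi) from the standard
    normal and ln |det R| = 1/2 ln((lam/2)^D / det S) from the Jacobian. Since 2 pi times lam/2 is
    lam pi, these combine to K / lam.\<close>
  have lnq: "lam * - ln (q z) = K + (z - m) \<bullet> (S *v (z - m))" for z
  proof -
    let ?x = "Q *v (z - m)"
    have "ln (\<Prod>i\<in>UNIV. std_normal_density (?x $ i)) = (\<Sum>i\<in>UNIV. ln (std_normal_density (?x $ i)))"
      by (rule ln_prod) (auto simp: std_normal_density_def)
    also have "\<dots> = (\<Sum>i\<in>UNIV. - (ln (2 * pi) / 2) - (?x $ i)\<^sup>2 / 2)"
      by (intro sum.cong refl) (simp add: std_normal_density_def ln_mult ln_div ln_sqrt)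
    also have "\<dots> = - (CARD('n) * ln (2 * pi) / 2) - (?x \<bullet> ?x) / 2"
      by (simp add: sum_subtractf inner_vec_def sum_divide_distrib power2_eq_square)
    finally have "ln (q z) = - (CARD('n) * ln (2 * pi) / 2) - (z - m) \<bullet> (S *v (z - m)) / lam - ln \<bar>det R\<bar>"
      unfolding q_def using detR0 by (subst ln_div) (auto simp: quad std_normal_density_def)
    moreover have "2 * ln \<bar>det R\<bar> = ln ((lam / 2) ^ CARD('n) / det S)"
      unfolding detR[symmetric] using detR0 ln_realpow[of "\<bar>det R\<bar>" 2] by simp
    moreover have "ln ((lam * pi) ^ CARD('n) / det S)
        = CARD('n) * ln (2 * pi) + ln ((lam / 2) ^ CARD('n) / det S)"
    proof -
      have "0 < (det R)\<^sup>2" using detR0 by simp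
      then have pos: "0 < (lam / 2) ^ CARD('n) / det S" by (simp only: detR)
      have "(lam * pi) ^ CARD('n) / det S = (2 * pi) ^ CARD('n) * ((lam / 2) ^ CARD('n) / det S)"
        by (subst times_divide_eq_right, subst power_mult_distrib[symmetric])
          (simp add: mult.commute)
      moreover have "ln ((2 * pi) ^ CARD('n) * ((lam / 2) ^ CARD('n) / det S))
          = ln ((2 * pi) ^ CARD('n)) + ln ((lam / 2) ^ CARD('n) / det S)"
        using pos by (intro ln_mult_pos) auto
      moreover have "ln ((2 * pi) ^ CARD('n)) = CARD('n) * ln (2 * pi)"
        by (rule ln_realpow)
      ultimately show ?thesis by metis
    qed
    moreover have "lam * - (- (A / 2) - B / lam - C) = lam / 2 * (A + 2 * C) + B" for A B C
      using lam by (simp add: field_simps)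
    ultimately show ?thesis unfolding K_def by simp
  qed
  have ln_int: "integrable gauss (\<lambda>u. ln (q (F u)))" 
    and cross: "lam * - (\<integral>u. ln (q (F u)) \<partial>gauss) = K + cost F" if F: "F \<in> sq_maps" for F
  proof -
    have eq: "ln (q z) = (- 1 / lam) * (K + (z - m) \<bullet> (S *v (z - m)))" for z
      unfolding lnq[symmetric] using lam by simp
    note i = integrable_quadratic_form[OF sq_maps_diff[OF F], of m S]
    show "integrable gauss (\<lambda>u. ln (q (F u)))" unfolding eq using i by simp
    show "lam * - (\<integral>u. ln (q (F u)) \<partial>gauss) = K + cost F"
      unfolding eq cost_def using i lam by (simp add: gauss.prob_space[simplified])
  qed
  have sq: "F \<in> class_A \<Longrightarrow> F \<in> sq_maps" for F by (simp add: class_A_def)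
  show A: "(\<lambda>u. m + R *v u) \<in> class_A" by (rule affine_class_A[OF invR])
  show "ereal lam * Ent F \<le> ereal (K + cost F)" if F: "F \<in> class_A"
  proof -
    have "ereal lam * Ent F \<le> ereal lam * ereal (- (\<integral>u. ln (q (F u)) \<partial>gauss))"
      using lam by (intro ereal_mult_left_mono Ent_le_cross_entropy F qm qpos one ln_int sq) auto
    also have "\<dots> = ereal (K + cost F)" using cross[OF sq[OF F]] by simp
    finally show ?thesis .
  qed
  show "ereal lam * Ent (\<lambda>u. m + R *v u) = ereal (K + cost (\<lambda>u. m + R *v u))"
    using Ent_eq_cross_entropy[OF A qm qpos law ln_int[OF sq[OF A]]] cross[OF sq[OF A]] by simp
qed

section \<open>The jump integral\<close>

text \<open>Chebyshev: the complement of each ball about 0 has finite mass by the second moment.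
  Countably many of these cover everything except the origin, which is a null set.\<close>

lemma sigma_finite_square_integrable:
  fixes \<nu> :: "(real^'n) measure"
  assumes sets: "sets \<nu> = sets borel" and zero: "emeasure \<nu> {0} = 0"
    and int: "(\<integral>\<^sup>+ e. ennreal ((norm e)\<^sup>2) \<partial>\<nu>) < \<infinity>"
  shows "sigma_finite_measure \<nu>"
proof
  let ?A = "\<lambda>n::nat. {e :: real^'n. 1 / Suc n \<le> norm e}"
  note [measurable_cong] = sets
  have space: "space \<nu> = UNIV" using sets_eq_imp_space_eq[OF sets] by simp
  have A [measurable]: "?A n \<in> sets \<nu>" for n by measurable
  have zero_sets: "{0} \<in> sets \<nu>" by (simp add: sets)
  have fin: "emeasure \<nu> (?A n) \<noteq> \<infinity>" for n
  proof -
    have "emeasure \<nu> (?A n) = (\<integral>\<^sup>+ e. indicator (?A n) e \<partial>\<nu>)" by simp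
    also have "\<dots> \<le> (\<integral>\<^sup>+ e. ennreal ((Suc n)\<^sup>2) * ennreal ((norm e)\<^sup>2) \<partial>\<nu>)"
    proof (intro nn_integral_mono)
      fix e :: "real^'n"
      have "1 \<le> (Suc n)\<^sup>2 * (norm e)\<^sup>2" if "1 / Suc n \<le> norm e"
      proof -
        have "1 \<le> Suc n * norm e" using that by (simp add: field_simps)
        then have "1\<^sup>2 \<le> (Suc n * norm e)\<^sup>2" by (intro power_mono) auto
        then show ?thesis by (simp only: power_mult_distrib power_one of_nat_power)
      qed
      then show "indicator (?A n) e \<le> ennreal ((Suc n)\<^sup>2) * ennreal ((norm e)\<^sup>2)"
        by (auto simp: indicator_def simp flip: ennreal_mult)
    qed
    also have "\<dots> = ennreal ((Suc n)\<^sup>2) * (\<integral>\<^sup>+ e. ennreal ((norm e)\<^sup>2) \<partial>\<nu>)"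
      by (rule nn_integral_cmult) measurable
    also have "\<dots> < \<infinity>" using int by (simp add: ennreal_mult_less_top)
    finally show ?thesis by simp
  qed
  have "\<exists>n. e \<in> ?A n" if "e \<noteq> 0" for e
    using reals_Archimedean[of "norm e"] that by (auto simp: inverse_eq_divide intro: less_imp_le)
  then have "\<Union> (insert {0} (range ?A)) = space \<nu>" by (auto simp: space)
  moreover have "insert {0} (range ?A) \<subseteq> sets \<nu>" using A zero_sets by blast
  ultimately show "\<exists>A. countable A \<and> A \<subseteq> sets \<nu> \<and> \<Union> A = space \<nu> \<and> (\<forall>a\<in>A. emeasure \<nu> a \<noteq> \<infinity>)"
    using fin zero by (intro exI[of _ "insert {0} (range ?A)"] conjI) (simp_all del: Union_insert)
qed

text \<open>Supplies the majorants for the jump integrand, which are products of a function of e and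
  a function of u.\<close>

lemma (in pair_sigma_finite) integrable_pair_mult:
  fixes f g :: "_ \<Rightarrow> real"
  assumes f: "integrable M1 f" and g: "integrable M2 g"
  shows "integrable (M1 \<Otimes>\<^sub>M M2) (\<lambda>(x, y). f x * g y)"
proof (rule Fubini_integrable)
  note [measurable] = borel_measurable_integrable[OF f] borel_measurable_integrable[OF g]
  show "(\<lambda>(x, y). f x * g y) \<in> borel_measurable (M1 \<Otimes>\<^sub>M M2)" by measurable
  show "integrable M1 (\<lambda>x. \<integral>y. norm (case (x, y) of (x, y) \<Rightarrow> f x * g y) \<partial>M2)"
    using f g by (simp add: abs_mult)
  show "AE x in M1. integrable M2 (\<lambda>y. case (x, y) of (x, y) \<Rightarrow> f x * g y)"
    using g by simp
qed

lemma integrable_scaleR_outer: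
  assumes sets: "sets \<nu> = sets borel" and k: "k \<in> borel_measurable borel"
    and int: "integrable \<nu> (\<lambda>e. k e * (norm e)\<^sup>2)"
  shows "integrable \<nu> (\<lambda>e :: real^'n. k e *\<^sub>R outer e e)"
proof (rule Bochner_Integration.integrable_bound[OF int])
  note [measurable_cong] = sets and [measurable] = k
  show "(\<lambda>e. k e *\<^sub>R outer e e) \<in> borel_measurable \<nu>" by measurable
qed (simp add: norm_outer power2_eq_square abs_mult)

lemma outer_quadratic_form: "y \<bullet> ((c *\<^sub>R outer e e) *v y) = c * (y \<bullet> e)\<^sup>2"
proof -
  have "outer e e *v y = (e \<bullet> y) *\<^sub>R e"
    by (simp add: vec_eq_iff outer_def matrix_vector_mult_def inner_vec_def sum_distrib_left
        sum_distrib_right mult_ac)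
  then show ?thesis
    by (simp add: scaleR_matrix_vector_assoc[symmetric] power2_eq_square inner_commute)
qed

lemma bounded_linear_quadratic_form: "bounded_linear (\<lambda>X :: real^'n^'n. y \<bullet> (X *v y))"
  unfolding linear_conv_bounded_linear[symmetric]
  by (rule linearI)
    (simp_all add: matrix_vector_mult_add_rdistrib inner_add_right scaleR_matrix_vector_assoc[symmetric])

text \<open>Moves a test vector inside the matrix-valued integral, so that the jump part of
  \<open>scriptS\<close> is handled through scalar integrals.\<close>

lemma integral_outer_quadratic_form:
  fixes k :: "real^'n \<Rightarrow> real"
  assumes "sets \<nu> = sets borel" "k \<in> borel_measurable borel" "integrable \<nu> (\<lambda>e. k e * (norm e)\<^sup>2)"
  shows "integrable \<nu> (\<lambda>e. k e * (y \<bullet> e)\<^sup>2)"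
    and "y \<bullet> ((\<integral>e. k e *\<^sub>R outer e e \<partial>\<nu>) *v y) = (\<integral>e. k e * (y \<bullet> e)\<^sup>2 \<partial>\<nu>)"
  using integrable_bounded_linear[OF bounded_linear_quadratic_form[of y] integrable_scaleR_outer[OF assms]]
    integral_bounded_linear[OF bounded_linear_quadratic_form[of y] integrable_scaleR_outer[OF assms]]
  by (simp_all add: outer_quadratic_form)

lemma congruence_quadratic_form:
  "x \<bullet> ((G ** X ** transpose G) *v x) = (transpose G *v x) \<bullet> (X *v (transpose G *v x))"
  for G X :: "real^'n^'n"
  by (simp add: transpose_inner[of "transpose G"] del: transpose_matrix_vector flip: matrix_vector_mul_assoc)

text \<open>Here r is the compensated jump of the value at a frozen x, while d and k are the weights
  of the terms linear and quadratic in F. Cauchy-Schwarz bounds these two terms by products of |d|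
  norm e with norm F, and of |k| (norm e)^2 with (norm F)^2; the integrability assumptions on d and
  k are those delivered by \<open>Upsilon1\<close> and \<open>Upsilon0\<close>.\<close>

lemma integral_jump:
  fixes \<nu> :: "(real^'n) measure" and d k r :: "real^'n \<Rightarrow> real"
    and G :: "real^'n^'n" and c :: real
  assumes sets: "sets \<nu> = sets borel" and sf: "sigma_finite_measure \<nu>"
    and F: "F \<in> sq_maps"
    and r: "integrable \<nu> r"
    and d: "d \<in> borel_measurable borel" "integrable \<nu> (\<lambda>e. d e * norm e)"
    and k: "k \<in> borel_measurable borel" "integrable \<nu> (\<lambda>e. k e * (norm e)\<^sup>2)"
  defines "J \<equiv> \<lambda>(e, u). r e + c * (d e * (F u \<bullet> (G *v e))) + k e * (F u \<bullet> (G *v e))\<^sup>2"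
  shows "integrable (\<nu> \<Otimes>\<^sub>M gauss) J"
    and "(\<integral>p. J p \<partial>(\<nu> \<Otimes>\<^sub>M gauss)) = (\<integral>e. r e \<partial>\<nu>)
      + c * (mean_map F \<bullet> (G *v (\<integral>e. d e *\<^sub>R e \<partial>\<nu>)))
      + (\<integral>u. F u \<bullet> ((G ** (\<integral>e. k e *\<^sub>R outer e e \<partial>\<nu>) ** transpose G) *v F u) \<partial>gauss)"
proof -
  interpret N: sigma_finite_measure \<nu> by (rule sf)
  interpret P: pair_sigma_finite \<nu> "gauss :: (real^'n) measure" ..
  note [measurable_cong] = sets
  note [measurable] = sq_mapsD(1)[OF F] d(1) k(1) borel_measurable_integrable[OF r]
  have G [measurable]: "(\<lambda>e. G *v e) \<in> borel_measurable borel"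
    by (intro borel_measurable_continuous_onI matrix_vector_mult_linear_continuous_on)
  obtain B where B: "0 < B" "\<And>e. norm (G *v e) \<le> norm e * B"
    using bounded_linear.pos_bounded[OF matrix_vector_mul_bounded_linear] by blast
  have FG: "\<bar>F u \<bullet> (G *v e)\<bar> \<le> B * norm e * norm (F u)" for u e
  proof -
    have "\<bar>F u \<bullet> (G *v e)\<bar> \<le> norm (F u) * norm (G *v e)" by (rule Cauchy_Schwarz_ineq2)
    also have "\<dots> \<le> norm (F u) * (norm e * B)" by (intro mult_left_mono B norm_ge_zero)
    finally show ?thesis by (simp add: mult_ac)
  qed
  have 1: "integrable (\<nu> \<Otimes>\<^sub>M gauss) (\<lambda>(e, u :: real^'n). r e)"
    using P.integrable_pair_mult[OF r gauss.integrable_const[of 1]] by simp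
  have 2: "integrable (\<nu> \<Otimes>\<^sub>M gauss) (\<lambda>(e, u). d e * (F u \<bullet> (G *v e)))"
  proof (rule Bochner_Integration.integrable_bound)
    show "integrable (\<nu> \<Otimes>\<^sub>M gauss) (\<lambda>(e, u). (B * (d e * norm e)) * norm (F u))"
      by (intro P.integrable_pair_mult Bochner_Integration.integrable_mult_right d sq_mapsD[OF F])
    have "\<bar>d e * (F u \<bullet> (G *v e))\<bar> \<le> \<bar>B * (d e * norm e) * norm (F u)\<bar>" for e u
      using mult_left_mono[OF FG[of u e], of "\<bar>d e\<bar>"] B(1) by (simp add: abs_mult mult_ac)
    then show "AE p in \<nu> \<Otimes>\<^sub>M gauss. norm (case p of (e, u) \<Rightarrow> d e * (F u \<bullet> (G *v e)))
        \<le> norm (case p of (e, u) \<Rightarrow> B * (d e * norm e) * norm (F u))"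
      by (intro AE_I2) (auto split: prod.split)
  qed measurable
  have 3: "integrable (\<nu> \<Otimes>\<^sub>M gauss) (\<lambda>(e, u). k e * (F u \<bullet> (G *v e))\<^sup>2)"
  proof (rule Bochner_Integration.integrable_bound)
    show "integrable (\<nu> \<Otimes>\<^sub>M gauss) (\<lambda>(e, u). (B\<^sup>2 * (k e * (norm e)\<^sup>2)) * (norm (F u))\<^sup>2)"
      by (intro P.integrable_pair_mult Bochner_Integration.integrable_mult_right k sq_mapsD[OF F])
    have "\<bar>k e * (F u \<bullet> (G *v e))\<^sup>2\<bar> \<le> \<bar>B\<^sup>2 * (k e * (norm e)\<^sup>2) * (norm (F u))\<^sup>2\<bar>" for e u
    proof -
      have "(F u \<bullet> (G *v e))\<^sup>2 \<le> (B * norm e * norm (F u))\<^sup>2"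
        using power_mono[OF FG[of u e], of 2] by simp
      from mult_left_mono[OF this, of "\<bar>k e\<bar>"] show ?thesis
        by (simp add: abs_mult power_mult_distrib mult_ac)
    qed
    then show "AE p in \<nu> \<Otimes>\<^sub>M gauss. norm (case p of (e, u) \<Rightarrow> k e * (F u \<bullet> (G *v e))\<^sup>2)
        \<le> norm (case p of (e, u) \<Rightarrow> B\<^sup>2 * (k e * (norm e)\<^sup>2) * (norm (F u))\<^sup>2)"
      by (intro AE_I2) (auto split: prod.split)
  qed measurable
  show J: "integrable (\<nu> \<Otimes>\<^sub>M gauss) J"
    using Bochner_Integration.integrable_add[OF Bochner_Integration.integrable_add[OF 1
        Bochner_Integration.integrable_mult_right[OF 2, of c]] 3]
    by (simp add: J_def split_beta')
  define K where "K = (\<integral>e. k e *\<^sub>R outer e e \<partial>\<nu>)"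
  define D where "D = (\<integral>e. d e *\<^sub>R e \<partial>\<nu>)"
  have de: "integrable \<nu> (\<lambda>e. d e *\<^sub>R e)"
    by (rule Bochner_Integration.integrable_bound[OF d(2)]) (auto simp: abs_mult)
  have inner: "(\<integral>e. J (e, u) \<partial>\<nu>) = (\<integral>e. r e \<partial>\<nu>) + c * (F u \<bullet> (G *v D))
      + F u \<bullet> ((G ** K ** transpose G) *v F u)" for u
  proof -
    have bl: "bounded_linear (\<lambda>z. F u \<bullet> (G *v z))"
      using bounded_linear_compose[OF bounded_linear_inner_right matrix_vector_mul_bounded_linear] .
    have d1: "integrable \<nu> (\<lambda>e. d e * (F u \<bullet> (G *v e)))"
      "(\<integral>e. d e * (F u \<bullet> (G *v e)) \<partial>\<nu>) = F u \<bullet> (G *v D)"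
      using integrable_bounded_linear[OF bl de] integral_bounded_linear[OF bl de]
      by (simp_all add: matrix_vector_mult_scaleR D_def)
    have Ge: "F u \<bullet> (G *v e) = (transpose G *v F u) \<bullet> e" for e
      by (simp add: transpose_inner[of "transpose G"] del: transpose_matrix_vector)
    have k1: "integrable \<nu> (\<lambda>e. k e * (F u \<bullet> (G *v e))\<^sup>2)"
      "(\<integral>e. k e * (F u \<bullet> (G *v e))\<^sup>2 \<partial>\<nu>) = F u \<bullet> ((G ** K ** transpose G) *v F u)"
      unfolding Ge congruence_quadratic_form K_def
      using integral_outer_quadratic_form[OF sets k, of "transpose G *v F u"] by auto
    show ?thesis
      unfolding J_def prod.case using r d1 k1 by simp
  qed
  \<comment> \<open>Integrating over e first leaves fixed vectors and matrices that meet F u only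
    through linear and quadratic forms.\<close>
  have "(\<integral>p. J p \<partial>(\<nu> \<Otimes>\<^sub>M gauss)) = (\<integral>u. (\<integral>e. J (e, u) \<partial>\<nu>) \<partial>gauss)"
    using P.integral_snd[of "\<lambda>e u. J (e, u)"] J by simp
  also have "\<dots> = (\<integral>e. r e \<partial>\<nu>) + c * (mean_map F \<bullet> (G *v D))
      + (\<integral>u. F u \<bullet> ((G ** K ** transpose G) *v F u) \<partial>gauss)"
    unfolding inner mean_map_def
    using sq_mapsD(4)[OF F] integrable_quadratic_form[OF F]
    by (simp add: gauss.prob_space[simplified])
  finally show "(\<integral>p. J p \<partial>(\<nu> \<Otimes>\<^sub>M gauss)) = (\<integral>e. r e \<partial>\<nu>)
      + c * (mean_map F \<bullet> (G *v (\<integral>e. d e *\<^sub>R e \<partial>\<nu>)))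
      + (\<integral>u. F u \<bullet> ((G ** (\<integral>e. k e *\<^sub>R outer e e \<partial>\<nu>) ** transpose G) *v F u) \<partial>gauss)"
    unfolding K_def D_def .
qed

section \<open>Positive definiteness and completing the square\<close>

lemma symmetric_integral_outer:
  fixes k :: "real^'n \<Rightarrow> real"
  assumes "sets \<nu> = sets borel" "k \<in> borel_measurable borel" "integrable \<nu> (\<lambda>e. k e * (norm e)\<^sup>2)"
  shows "transpose (\<integral>e. k e *\<^sub>R outer e e \<partial>\<nu>) = (\<integral>e. k e *\<^sub>R outer e e \<partial>\<nu>)"
proof -
  have bl: "bounded_linear (transpose :: real^'n^'n \<Rightarrow> real^'n^'n)"
    unfolding linear_conv_bounded_linear[symmetric]
    by (rule linearI) (simp_all add: transpose_def vec_eq_iff)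
  have "transpose (c *\<^sub>R outer e e) = c *\<^sub>R outer e e" for c and e :: "real^'n"
    by (simp add: transpose_def outer_def vec_eq_iff)
  then show ?thesis
    using integral_bounded_linear[OF bl integrable_scaleR_outer[OF assms]] by simp
qed

text \<open>With strictly positive weights, a weighted form that vanishes at x forces both
  \<open>transpose a *v x\<close> = 0 and z.e = 0 for almost every e, where z is
  \<open>transpose G *v x\<close>. The unweighted form would then vanish at x as well, which its
  positive definiteness excludes.\<close>

lemma pos_def_weighted_sum:
  fixes a G :: "real^'n^'n" and k :: "real^'n \<Rightarrow> real"
  assumes sets: "sets \<nu> = sets borel"
    and sq: "integrable \<nu> (\<lambda>e. (norm e)\<^sup>2)"
    and k: "k \<in> borel_measurable borel" "integrable \<nu> (\<lambda>e. k e * (norm e)\<^sup>2)" "\<And>e. 0 < k e"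
    and c: "0 < c"
    and pd: "pos_def (a ** transpose a + G ** (\<integral>e. outer e e \<partial>\<nu>) ** transpose G)"
  shows "pos_def (c *\<^sub>R (a ** transpose a) + G ** (\<integral>e. k e *\<^sub>R outer e e \<partial>\<nu>) ** transpose G)"
    (is "pos_def ?S")
  unfolding pos_def_def
proof (intro conjI allI impI)
  let ?K = "\<integral>e. k e *\<^sub>R outer e e \<partial>\<nu>"
  have "transpose (X + Y) = transpose X + transpose Y" for X Y :: "real^'n^'n"
    by (simp add: transpose_def vec_eq_iff)
  moreover have "transpose (c *\<^sub>R X) = c *\<^sub>R transpose X" for X :: "real^'n^'n"
    by (simp add: transpose_def vec_eq_iff)
  ultimately show "transpose ?S = ?S"
    by (simp add: matrix_transpose_mul symmetric_integral_outer[OF sets k(1,2)] matrix_mul_assoc)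
  fix x :: "real^'n" assume x: "x \<noteq> 0"
  define y z where "y = transpose a *v x" and "z = transpose G *v x"
  have aa: "x \<bullet> ((a ** transpose a) *v x) = y \<bullet> y"
    using congruence_quadratic_form[of x a "mat 1"] by (simp add: y_def)
  have form: "x \<bullet> (?S *v x) = c * (y \<bullet> y) + (\<integral>e. k e * (z \<bullet> e)\<^sup>2 \<partial>\<nu>)"
    by (simp add: matrix_vector_mult_add_rdistrib inner_add_right scaleR_matrix_vector_assoc[symmetric]
        aa congruence_quadratic_form integral_outer_quadratic_form(2)[OF sets k(1,2)] z_def
        del: transpose_matrix_vector)
  have form1: "0 < y \<bullet> y + (\<integral>e. (z \<bullet> e)\<^sup>2 \<partial>\<nu>)"
    using pd x integral_outer_quadratic_form(2)[OF sets, of "\<lambda>_. 1" z] sq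
    unfolding pos_def_def
    by (auto simp: matrix_vector_mult_add_rdistrib inner_add_right aa congruence_quadratic_form z_def
        simp del: transpose_matrix_vector)
  have nonneg: "0 \<le> (\<integral>e. k e * (z \<bullet> e)\<^sup>2 \<partial>\<nu>)"
    using k(3) by (intro integral_nonneg_AE AE_I2) (simp add: less_imp_le)
  show "0 < x \<bullet> (?S *v x)"
  proof (cases "y = 0")
    case False
    then show ?thesis unfolding form using c nonneg by (intro add_pos_nonneg) auto
  next
    case True
    have "(\<integral>e. k e * (z \<bullet> e)\<^sup>2 \<partial>\<nu>) \<noteq> 0"
    proof
      assume "(\<integral>e. k e * (z \<bullet> e)\<^sup>2 \<partial>\<nu>) = 0"
      then have "AE e in \<nu>. k e * (z \<bullet> e)\<^sup>2 = 0"
        using integral_outer_quadratic_form(1)[OF sets k(1,2), of z] k(3)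
        by (subst (asm) integral_nonneg_eq_0_iff_AE) (auto simp: less_imp_le)
      then have "AE e in \<nu>. (z \<bullet> e)\<^sup>2 = 0"
        by eventually_elim (use k(3) in \<open>simp add: less_imp_neq[symmetric]\<close>)
      then have "(\<integral>e. (z \<bullet> e)\<^sup>2 \<partial>\<nu>) = 0" by (rule integral_eq_zero_AE)
      then show False using form1 True by simp
    qed
    then show ?thesis unfolding form using nonneg True by simp
  qed
qed

text \<open>The centre solves S m = - c M. Symmetry of S then makes both cross terms of the shifted
  form equal to c times the mean against M.\<close>

lemma complete_square:
  fixes S :: "real^'n^'n" and M :: "real^'n" and c :: real
  assumes S: "pos_def S" and F: "F \<in> sq_maps"
  defines "m \<equiv> - c *\<^sub>R (matrix_inv S *v M)"
  shows "(\<integral>u. F u \<bullet> (S *v F u) \<partial>gauss) + 2 * c * (mean_map F \<bullet> M)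
    = (\<integral>u. (F u - m) \<bullet> (S *v (F u - m)) \<partial>gauss) - c\<^sup>2 * (M \<bullet> (matrix_inv S *v M))"
proof -
  have Sm: "S *v m = - c *\<^sub>R M"
    by (simp add: m_def matrix_vector_mult_scaleR matrix_vector_mul_assoc pos_def_invertible[OF S]
        vec.neg flip: scaleR_minus_left)
  have "m \<bullet> (S *v mean_map F) = (S *v m) \<bullet> mean_map F"
    using symmetric_inner[of S] S by (simp add: pos_def_def)
  moreover have "m \<bullet> (S *v m) = c\<^sup>2 * (M \<bullet> (matrix_inv S *v M))"
    unfolding Sm by (simp add: m_def power2_eq_square inner_commute)
  ultimately show ?thesis
    unfolding integral_quadratic_form_shift[OF F] by (simp add: Sm inner_commute)
qed

section \<open>Derivatives of the quadratic ansatz\<close>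

lemma has_pd_iff: "has_pd f i y \<longleftrightarrow> ((\<lambda>s. f (y + s *\<^sub>R i)) has_real_derivative pd i f y) (at 0)"
  by (simp add: has_pd_def pd_def DERIV_deriv_iff_real_differentiable)

lemma pdI:
  assumes "((\<lambda>s. f (y + s *\<^sub>R i)) has_real_derivative D) (at 0)"
  shows "has_pd f i y" "pd i f y = D"
  using assms DERIV_imp_deriv real_differentiable_def by (auto simp: has_pd_def pd_def)

lemma pd_linear:
  assumes "has_pd f i y" "has_pd g i y"
  shows "has_pd (\<lambda>y. f y * c + g y) i y" and "pd i (\<lambda>y. f y * c + g y) y = pd i f y * c + pd i g y"
proof -
  have "((\<lambda>s. f (y + s *\<^sub>R i) * c + g (y + s *\<^sub>R i)) has_real_derivative pd i f y * c + pd i g y) (at 0)"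
    using assms by (intro DERIV_add DERIV_cmult_right) (simp_all add: has_pd_iff)
  then show "has_pd (\<lambda>y. f y * c + g y) i y" "pd i (\<lambda>y. f y * c + g y) y = pd i f y * c + pd i g y"
    by (rule pdI)+
qed

lemma C12D:
  assumes "f \<in> C12 T" "t \<in> {0..T}"
  shows C12_differentiable: "(\<lambda>s. f s y) differentiable (at t within {0..T})"
    and C12_has_pd: "i \<in> Basis \<Longrightarrow> has_pd (f t) i y"
    and C12_has_pd2: "i \<in> Basis \<Longrightarrow> j \<in> Basis \<Longrightarrow> has_pd (pd i (f t)) j y"
    and C12_measurable: "f t \<in> borel_measurable borel"
proof -
  show "(\<lambda>s. f s y) differentiable (at t within {0..T})"
    "i \<in> Basis \<Longrightarrow> has_pd (f t) i y"
    "i \<in> Basis \<Longrightarrow> j \<in> Basis \<Longrightarrow> has_pd (pd i (f t)) j y"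
    using assms by (auto simp: C12_def)
  have "continuous_on ({0..T} \<times> UNIV) (\<lambda>(t, y). f t y)" using assms by (simp add: C12_def)
  then have "continuous_on UNIV (\<lambda>y. case (t, y) of (t, y) \<Rightarrow> f t y)"
    using assms(2) by (intro continuous_on_compose2[of _ "\<lambda>(t, y). f t y" UNIV "\<lambda>y. (t, y)"] continuous_intros) auto
  then show "f t \<in> borel_measurable borel" by (simp add: borel_measurable_continuous_onI)
qed

text \<open>Because 0 < T, derivatives within {0..T} are unique, so \<open>vector_derivative\<close>
  returns the computed value at the endpoints too.\<close>

lemma dt_quadratic:
  assumes f: "f \<in> C12 T" and g: "g \<in> C12 T" and t: "t \<in> {0..T}" and T: "0 < T"
  shows "((\<lambda>s. f s y * c + g s y) has_vector_derivative dt T f t y * c + dt T g t y) (at t within {0..T})"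
    and "vector_derivative (\<lambda>s. f s y * c + g s y) (at t within {0..T}) = dt T f t y * c + dt T g t y"
proof -
  have "((\<lambda>s. h s y) has_vector_derivative dt T h t y) (at t within {0..T})" if "h \<in> C12 T" for h
    using C12_differentiable[OF that t] by (simp add: dt_def vector_derivative_works)
  then show *: "((\<lambda>s. f s y * c + g s y) has_vector_derivative dt T f t y * c + dt T g t y) (at t within {0..T})"
    using f g by (intro has_vector_derivative_add has_vector_derivative_mult_left)
  show "vector_derivative (\<lambda>s. f s y * c + g s y) (at t within {0..T}) = dt T f t y * c + dt T g t y"
    using vector_derivative_within_cbox[of 0 T t] t T * by (simp add: cbox_interval)
qed

lemma v_opt_deriv_x:
  shows "deriv (\<lambda>x'. v_opt w \<alpha> \<beta> t x' y) = (\<lambda>x. 2 * \<alpha> t y * (x - w))"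
    and "deriv (\<lambda>x. 2 * \<alpha> t y * (x - w)) = (\<lambda>x. 2 * \<alpha> t y)"
proof -
  have "((\<lambda>x'. v_opt w \<alpha> \<beta> t x' y) has_real_derivative 2 * \<alpha> t y * (x - w)) (at x)" for x
    unfolding v_opt_def by (auto intro!: derivative_eq_intros)
  then show "deriv (\<lambda>x'. v_opt w \<alpha> \<beta> t x' y) = (\<lambda>x. 2 * \<alpha> t y * (x - w))"
    by (auto intro: DERIV_imp_deriv)
  have "((\<lambda>x. 2 * \<alpha> t y * (x - w)) has_real_derivative 2 * \<alpha> t y) (at x)" for x
    by (auto intro!: derivative_eq_intros)
  then show "deriv (\<lambda>x. 2 * \<alpha> t y * (x - w)) = (\<lambda>x. 2 * \<alpha> t y)"
    by (auto intro: DERIV_imp_deriv)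
qed

lemma axis_Basis: "axis i (1::real) \<in> Basis"
  by (auto simp: Basis_vec_def)

lemma v_opt_deriv_y:
  fixes \<alpha> \<beta> :: "real \<Rightarrow> real^'n \<Rightarrow> real"
  assumes f: "\<alpha> \<in> C12 T" and g: "\<beta> \<in> C12 T" and t: "t \<in> {0..T}" and T: "0 < T"
  shows "grad (v_opt w \<alpha> \<beta> t x) y = (x - w)\<^sup>2 *\<^sub>R grad (\<alpha> t) y + grad (\<beta> t) y"
    and "hess (v_opt w \<alpha> \<beta> t x) y = (x - w)\<^sup>2 *\<^sub>R hess (\<alpha> t) y + hess (\<beta> t) y"
    and "deriv (\<lambda>x'. grad (v_opt w \<alpha> \<beta> t x') y $ i) x = 2 * (x - w) * grad (\<alpha> t) y $ i"
    and "dt T (\<lambda>s. v_opt w \<alpha> \<beta> s x) t y = dt T \<alpha> t y * (x - w)\<^sup>2 + dt T \<beta> t y"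
proof -
  have v: "v_opt w \<alpha> \<beta> t x = (\<lambda>y. \<alpha> t y * (x - w)\<^sup>2 + \<beta> t y)" for x
    by (simp add: v_opt_def fun_eq_iff)
  have pd1: "pd (axis i 1) (v_opt w \<alpha> \<beta> t x) y = pd (axis i 1) (\<alpha> t) y * (x - w)\<^sup>2 + pd (axis i 1) (\<beta> t) y" for i x y
    unfolding v by (intro pd_linear C12_has_pd[OF f t] C12_has_pd[OF g t] axis_Basis)
  then show grad: "grad (v_opt w \<alpha> \<beta> t x) y = (x - w)\<^sup>2 *\<^sub>R grad (\<alpha> t) y + grad (\<beta> t) y" for x
    by (simp add: grad_def vec_eq_iff mult.commute)
  have "pd (axis i 1) (pd (axis j 1) (v_opt w \<alpha> \<beta> t x)) y =
      pd (axis i 1) (pd (axis j 1) (\<alpha> t)) y * (x - w)\<^sup>2 + pd (axis i 1) (pd (axis j 1) (\<beta> t)) y" for i j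
    unfolding pd1[abs_def] by (intro pd_linear C12_has_pd2[OF f t] C12_has_pd2[OF g t] axis_Basis)
  then show "hess (v_opt w \<alpha> \<beta> t x) y = (x - w)\<^sup>2 *\<^sub>R hess (\<alpha> t) y + hess (\<beta> t) y"
    by (simp add: hess_def vec_eq_iff mult.commute)
  have "((\<lambda>x'. (x' - w)\<^sup>2 * grad (\<alpha> t) y $ i + grad (\<beta> t) y $ i) has_real_derivative
      2 * (x - w) * grad (\<alpha> t) y $ i) (at x)"
    by (auto intro!: derivative_eq_intros)
  then show "deriv (\<lambda>x'. grad (v_opt w \<alpha> \<beta> t x') y $ i) x = 2 * (x - w) * grad (\<alpha> t) y $ i"
    unfolding grad by (simp add: DERIV_imp_deriv)
  show "dt T (\<lambda>s. v_opt w \<alpha> \<beta> s x) t y = dt T \<alpha> t y * (x - w)\<^sup>2 + dt T \<beta> t y"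
    unfolding dt_def[of T "\<lambda>s. v_opt w \<alpha> \<beta> s x"] v_opt_def by (rule dt_quadratic(2)[OF f g t T])
qed

text \<open>Functions of the form \<open>A t y * p x + B t y\<close> are closed under both kinds of partial
  derivatives, so two applications of the following lemma give all second derivatives.\<close>

lemma pd_product_form:
  fixes A B :: "'a::euclidean_space \<Rightarrow> real"
  assumes p: "\<And>x. (p has_real_derivative p' x) (at x)"
  defines "f \<equiv> \<lambda>(x, y). A y * p x + B y"
  shows "has_pd f (1, 0) z" and "pd (1, 0) f = (\<lambda>(x, y). A y * p' x + 0)"
    and "(\<And>y. has_pd A j y) \<Longrightarrow> (\<And>y. has_pd B j y) \<Longrightarrow> has_pd f (0, j) z"
    and "(\<And>y. has_pd A j y) \<Longrightarrow> (\<And>y. has_pd B j y) \<Longrightarrow>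
      pd (0, j) f = (\<lambda>(x, y). pd j A y * p x + pd j B y)"
proof -
  have 1: "((\<lambda>s. f (z + s *\<^sub>R (1, 0))) has_real_derivative A (snd z) * p' (fst z)) (at 0)" for z
  proof -
    have "((\<lambda>s. A (snd z) * p (fst z + s) + B (snd z)) has_real_derivative A (snd z) * (p' (fst z + 0) * 1) + 0) (at 0)"
      by (intro DERIV_add DERIV_cmult DERIV_const DERIV_chain'[OF _ p] derivative_eq_intros) auto
    then show ?thesis by (simp add: f_def split_beta')
  qed
  from pdI[OF 1] show "has_pd f (1, 0) z" "pd (1, 0) f = (\<lambda>(x, y). A y * p' x + 0)"
    by (auto simp: fun_eq_iff)
  assume AB: "\<And>y. has_pd A j y" "\<And>y. has_pd B j y"
  have 2: "((\<lambda>s. f (z + s *\<^sub>R (0, j))) has_real_derivative pd j A (snd z) * p (fst z) + pd j B (snd z)) (at 0)" for z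
  proof -
    have "((\<lambda>s. A (snd z + s *\<^sub>R j) * p (fst z) + B (snd z + s *\<^sub>R j)) has_real_derivative
        pd j A (snd z) * p (fst z) + pd j B (snd z)) (at 0)"
      using AB by (intro DERIV_add DERIV_cmult_right) (simp_all add: has_pd_iff)
    then show ?thesis by (simp add: f_def split_beta')
  qed
  from pdI[OF 2] show "has_pd f (0, j) z" "pd (0, j) f = (\<lambda>(x, y). pd j A y * p x + pd j B y)"
    by (auto simp: fun_eq_iff)
qed

lemma continuous_on_product_form:
  fixes A B :: "real \<Rightarrow> 'a::euclidean_space \<Rightarrow> real" and p :: "real \<Rightarrow> real"
  assumes "continuous_on ({0..T} \<times> UNIV) (\<lambda>(t, y). A t y)" "continuous_on ({0..T} \<times> UNIV) (\<lambda>(t, y). B t y)"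
    and "continuous_on UNIV p"
  shows "continuous_on ({0..T} \<times> UNIV) (\<lambda>(t, x, y). A t y * p x + B t y)"
proof -
  have "continuous_on ({0..T} \<times> UNIV) (\<lambda>z. case (fst z, snd (snd z)) of (t, y) \<Rightarrow> C t y)"
    if "continuous_on ({0..T} \<times> UNIV) (\<lambda>(t, y). C t y)" for C :: "real \<Rightarrow> 'a \<Rightarrow> real"
    by (rule continuous_on_compose2[OF that]) (auto intro!: continuous_intros)
  note this[OF assms(1)] this[OF assms(2)]
  moreover have "continuous_on ({0..T} \<times> UNIV) (\<lambda>z :: real \<times> real \<times> 'a. p (fst (snd z)))"
    by (rule continuous_on_compose2[OF assms(3)]) (auto intro!: continuous_intros)
  ultimately show ?thesis by (auto simp: split_beta' intro!: continuous_intros)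
qed

text \<open>The basis of the product space consists of (1, 0) and the vectors (0, j). Every
  derivative up to second order is again of product form: differentiating in x replaces p by p' and
  p' by 2, differentiating in y acts on the coefficients.\<close>

lemma v_opt_C12:
  fixes \<alpha> \<beta> :: "real \<Rightarrow> real^'n \<Rightarrow> real"
  assumes f: "\<alpha> \<in> C12 T" and g: "\<beta> \<in> C12 T" and T: "0 < T"
  shows "(\<lambda>t (x, y). v_opt w \<alpha> \<beta> t x y) \<in> C12 T"
proof -
  let ?v = "\<lambda>t (x, y). v_opt w \<alpha> \<beta> t x y"
  define p p' :: "real \<Rightarrow> real" where "p x = (x - w)\<^sup>2" and "p' x = 2 * (x - w)" for x
  have p: "(p has_real_derivative p' x) (at x)" and p': "(p' has_real_derivative 2) (at x)" for x
    unfolding p_def[abs_def] p'_def[abs_def] by (auto intro!: derivative_eq_intros)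
  have cp: "continuous_on UNIV p" "continuous_on UNIV p'" "continuous_on UNIV (\<lambda>_ :: real. 2 :: real)"
    unfolding p_def[abs_def] p'_def[abs_def] by (auto intro!: continuous_intros)
  have v: "?v t = (\<lambda>(x, y). \<alpha> t y * p x + \<beta> t y)" for t
    by (auto simp: v_opt_def p_def)
  have zero: "has_pd (\<lambda>_. 0 :: real) j y" "pd j (\<lambda>_. 0 :: real) y = 0" for j y :: "real^'n"
    using pdI[of "\<lambda>_. 0" y j 0] by simp_all
  note hp = C12_has_pd[OF f] C12_has_pd[OF g] C12_has_pd2[OF f] C12_has_pd2[OF g]
  note cont = f[unfolded C12_def, simplified] g[unfolded C12_def, simplified]
  have c0: "continuous_on ({0..T} \<times> UNIV) (\<lambda>(t :: real, y :: real^'n). 0 :: real)" by (simp add: split_beta')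
  have dtv: "dt T ?v t z = (case z of (x, y) \<Rightarrow> dt T \<alpha> t y * p x + dt T \<beta> t y)" if "t \<in> {0..T}" for t z
  proof (cases z)
    case (Pair a b)
    have "dt T ?v t (a, b) = vector_derivative (\<lambda>s. \<alpha> s b * p a + \<beta> s b) (at t within {0..T})"
      by (simp add: dt_def v_opt_def p_def)
    then show ?thesis using dt_quadratic(2)[OF f g that T] Pair by simp
  qed
  have dx: "has_pd (?v t) (1, 0) z" "pd (1, 0) (?v t) = (\<lambda>(x, y). \<alpha> t y * p' x + 0)" for t z
    unfolding v by (rule pd_product_form[OF p])+
  have dy: "has_pd (?v t) (0, j) z" "pd (0, j) (?v t) = (\<lambda>(x, y). pd j (\<alpha> t) y * p x + pd j (\<beta> t) y)"
    if "t \<in> {0..T}" "j \<in> Basis" for t j z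
    unfolding v using that by (auto intro!: pd_product_form[OF p] hp)
  have dxx: "has_pd (\<lambda>(x, y). \<alpha> t y * p' x + 0) (1, 0) z"
     "pd (1, 0) (\<lambda>(x, y). \<alpha> t y * p' x + 0) = (\<lambda>(x, y). \<alpha> t y * 2 + 0)" for t and z :: "real \<times> (real^'n)"
    by (rule pd_product_form[OF p'])+
  have dxy: "has_pd (\<lambda>(x, y). \<alpha> t y * p' x + 0) (0, j) z"
     "pd (0, j) (\<lambda>(x, y). \<alpha> t y * p' x + 0) = (\<lambda>(x, y). pd j (\<alpha> t) y * p' x + 0)"
     if "t \<in> {0..T}" "j \<in> Basis" for t j z
    using that pd_product_form(3,4)[OF p', where B = "\<lambda>_. 0" and A = "\<alpha> t" and j = j] zero hp by auto
  have dyx: "has_pd (\<lambda>(x, y). pd j (\<alpha> t) y * p x + pd j (\<beta> t) y) (1, 0) z"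
     "pd (1, 0) (\<lambda>(x, y). pd j (\<alpha> t) y * p x + pd j (\<beta> t) y) = (\<lambda>(x, y). pd j (\<alpha> t) y * p' x + 0)" for t j z
    by (rule pd_product_form[OF p])+
  have dyy: "has_pd (\<lambda>(x, y). pd j (\<alpha> t) y * p x + pd j (\<beta> t) y) (0, k) z"
     "pd (0, k) (\<lambda>(x, y). pd j (\<alpha> t) y * p x + pd j (\<beta> t) y) =
       (\<lambda>(x, y). pd k (pd j (\<alpha> t)) y * p x + pd k (pd j (\<beta> t)) y)"
     if "t \<in> {0..T}" "j \<in> Basis" "k \<in> Basis" for t j k z
    using that by (auto intro!: pd_product_form[OF p] hp)
  \<comment> \<open>Some of the derivative formulas hold only for times in {0..T}, so continuity is
    transferred by agreement on that set instead of rewriting under the binder.\<close>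
  have cong: "continuous_on ({0..T} \<times> UNIV) (\<lambda>(t, z). H t z)"
    if "continuous_on ({0..T} \<times> UNIV) (\<lambda>(t, x, y). K t x y)" "\<And>t x y. t \<in> {0..T} \<Longrightarrow> H t (x, y) = K t x y"
    for H :: "real \<Rightarrow> real \<times> (real^'n) \<Rightarrow> real" and K
    using that by (subst continuous_on_cong[OF refl, where g = "\<lambda>(t, x, y). K t x y"]) auto
  show ?thesis
    unfolding C12_def Basis_prod_def
  proof (intro CollectI conjI ballI allI)
    show "continuous_on ({0..T} \<times> UNIV) (\<lambda>(t, z). ?v t z)"
      by (rule cong[OF continuous_on_product_form[of T \<alpha> \<beta> p]]) (use cont cp in \<open>auto simp: v\<close>)
    show "continuous_on ({0..T} \<times> UNIV) (\<lambda>(t, z). dt T ?v t z)"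
      by (rule cong[OF continuous_on_product_form[of T "dt T \<alpha>" "dt T \<beta>" p]]) (use cont cp in \<open>auto simp: dtv\<close>)
    show "(\<lambda>s. ?v s z) differentiable (at t within {0..T})" if "t \<in> {0..T}" for t z
      using dt_quadratic(1)[OF f g that T] unfolding v
      by (cases z) (auto intro: differentiableI_vector)
  next
    fix i :: "real \<times> (real^'n)" assume "i \<in> (\<lambda>u. (u, 0)) ` Basis \<union> (\<lambda>u. (0, u)) ` Basis"
    then consider "i = (1, 0)" | j where "j \<in> Basis" "i = (0, j)" by auto
    then have "(\<forall>t\<in>{0..T}. \<forall>z. has_pd (?v t) i z) \<and>
        continuous_on ({0..T} \<times> UNIV) (\<lambda>(t, z). pd i (?v t) z) \<and>
        (\<forall>k\<in>(\<lambda>u. (u, 0)) ` Basis \<union> (\<lambda>u. (0, u)) ` Basis.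
           (\<forall>t\<in>{0..T}. \<forall>z. has_pd (pd i (?v t)) k z) \<and>
           continuous_on ({0..T} \<times> UNIV) (\<lambda>(t, z). pd k (pd i (?v t)) z))"
    proof cases
      case 1
      have "continuous_on ({0..T} \<times> UNIV) (\<lambda>(t, z). pd i (?v t) z)"
        by (rule cong[OF continuous_on_product_form[of T \<alpha> "\<lambda>_ _. 0" p']]) (use cont cp c0 in \<open>auto simp: 1 dx\<close>)
      moreover have "continuous_on ({0..T} \<times> UNIV) (\<lambda>(t, z). pd (1, 0) (pd i (?v t)) z)"
        by (rule cong[OF continuous_on_product_form[of T \<alpha> "\<lambda>_ _. 0" "\<lambda>_. 2"]]) (use cont cp c0 in \<open>auto simp: 1 dx dxx[simplified]\<close>)
      moreover have "continuous_on ({0..T} \<times> UNIV) (\<lambda>(t, z). pd (0, j) (pd i (?v t)) z)" if "j \<in> Basis" for j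
        by (rule cong[OF continuous_on_product_form[of T "\<lambda>t. pd j (\<alpha> t)" "\<lambda>_ _. 0" p']])
          (use cont cp c0 that in \<open>auto simp: 1 dx dxy[simplified]\<close>)
      ultimately show ?thesis using dx dxx dxy unfolding 1 by auto
    next
      case (2 j)
      have "continuous_on ({0..T} \<times> UNIV) (\<lambda>(t, z). pd i (?v t) z)"
        by (rule cong[OF continuous_on_product_form[of T "\<lambda>t. pd j (\<alpha> t)" "\<lambda>t. pd j (\<beta> t)" p]])
          (use 2 cont cp c0 in \<open>auto simp: dy\<close>)
      moreover have "continuous_on ({0..T} \<times> UNIV) (\<lambda>(t, z). pd (1, 0) (pd i (?v t)) z)"
        by (rule cong[OF continuous_on_product_form[of T "\<lambda>t. pd j (\<alpha> t)" "\<lambda>_ _. 0" p']])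
          (use 2 cont cp c0 in \<open>auto simp: dy dyx\<close>)
      moreover have "continuous_on ({0..T} \<times> UNIV) (\<lambda>(t, z). pd (0, k) (pd i (?v t)) z)" if "k \<in> Basis" for k
        by (rule cong[OF continuous_on_product_form[of T "\<lambda>t. pd k (pd j (\<alpha> t))" "\<lambda>t. pd k (pd j (\<beta> t))" p]])
          (use 2 cont cp c0 that in \<open>auto simp: dy dyy\<close>)
      ultimately show ?thesis using 2 dy dyx dyy by auto
    qed
    then show "t \<in> {0..T} \<Longrightarrow> has_pd (?v t) i z" 
      "continuous_on ({0..T} \<times> UNIV) (\<lambda>(t, z). pd i (?v t) z)" 
      "k \<in> (\<lambda>u. (u, 0)) ` Basis \<union> (\<lambda>u. (0, u)) ` Basis \<Longrightarrow> t \<in> {0..T} \<Longrightarrow> has_pd (pd i (?v t)) k z"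
      "k \<in> (\<lambda>u. (u, 0)) ` Basis \<union> (\<lambda>u. (0, u)) ` Basis \<Longrightarrow> 
        continuous_on ({0..T} \<times> UNIV) (\<lambda>(t, z). pd k (pd i (?v t)) z)" for t z k
      by blast+
  qed
qed

section \<open>The Hamiltonian of the quadratic ansatz\<close>

lemma cont_dominated_finite:
  "cont_dominated T G \<Longrightarrow> t \<in> {0..T} \<Longrightarrow> G t y < \<infinity>"
  unfolding cont_dominated_def by (metis ennreal_less_top infinity_ennreal_def le_less_trans)

lemma integrable_if_nn_integral_abs:
  fixes g :: "'a \<Rightarrow> real"
  assumes "g \<in> borel_measurable M" "(\<integral>\<^sup>+ e. ennreal \<bar>g e\<bar> \<partial>M) < \<infinity>"
  shows "integrable M g"
  using assms by (intro integrableI_bounded) auto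

text \<open>The \<open>Upsilon\<close> classes bound nonnegative integrals; Bochner integrability at
  a fixed point also needs measurability, which comes from the continuity in
  \<open>C12\<close>.\<close>

lemma integrable_jump_parts:
  fixes f :: "real \<Rightarrow> real^'n \<Rightarrow> real"
  assumes sets: "sets \<nu> = sets borel" and f: "f \<in> C12 T" and t: "t \<in> {0..T}"
  shows "(\<lambda>e. f t (y + \<gamma> y *v e)) \<in> borel_measurable borel"
    and "f \<in> Upsilon0 T \<gamma> \<nu> \<Longrightarrow> integrable \<nu> (\<lambda>e. f t (y + \<gamma> y *v e) * (norm e)\<^sup>2)"
    and "f \<in> Upsilon1 T \<gamma> \<nu> \<Longrightarrow> integrable \<nu> (\<lambda>e. (f t (y + \<gamma> y *v e) - f t y) * norm e)"
    and "f \<in> Upsilon2 T \<gamma> \<nu> \<Longrightarrow>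
      integrable \<nu> (\<lambda>e. f t (y + \<gamma> y *v e) - f t y - grad (f t) y \<bullet> (\<gamma> y *v e))"
proof -
  note [measurable_cong] = sets and [measurable] = C12_measurable[OF f t]
  have shift [measurable]: "(\<lambda>e. y + \<gamma> y *v e) \<in> borel_measurable borel"
    by (intro borel_measurable_continuous_onI continuous_intros matrix_vector_mult_linear_continuous_on)
  have [measurable]: "(\<lambda>e. grad (f t) y \<bullet> (\<gamma> y *v e)) \<in> borel_measurable borel"
    by (intro borel_measurable_continuous_onI continuous_intros matrix_vector_mult_linear_continuous_on)
  show [measurable]: "(\<lambda>e. f t (y + \<gamma> y *v e)) \<in> borel_measurable borel"
    using measurable_compose[OF shift C12_measurable[OF f t]] .
  show "integrable \<nu> (\<lambda>e. f t (y + \<gamma> y *v e) * (norm e)\<^sup>2)" if "f \<in> Upsilon0 T \<gamma> \<nu>"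
  proof (rule integrable_if_nn_integral_abs)
    show "(\<integral>\<^sup>+ e. ennreal \<bar>f t (y + \<gamma> y *v e) * (norm e)\<^sup>2\<bar> \<partial>\<nu>) < \<infinity>"
      using that cont_dominated_finite[OF _ t] by (force simp: Upsilon0_def abs_mult)
  qed measurable
  show "integrable \<nu> (\<lambda>e. (f t (y + \<gamma> y *v e) - f t y) * norm e)" if "f \<in> Upsilon1 T \<gamma> \<nu>"
  proof (rule integrable_if_nn_integral_abs)
    show "(\<integral>\<^sup>+ e. ennreal \<bar>(f t (y + \<gamma> y *v e) - f t y) * norm e\<bar> \<partial>\<nu>) < \<infinity>"
      using that cont_dominated_finite[OF _ t] by (force simp: Upsilon1_def abs_mult)
  qed measurable
  show "integrable \<nu> (\<lambda>e. f t (y + \<gamma> y *v e) - f t y - grad (f t) y \<bullet> (\<gamma> y *v e))"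
    if "f \<in> Upsilon2 T \<gamma> \<nu>"
  proof (rule integrable_if_nn_integral_abs)
    show "(\<integral>\<^sup>+ e. ennreal \<bar>f t (y + \<gamma> y *v e) - f t y - grad (f t) y \<bullet> (\<gamma> y *v e)\<bar> \<partial>\<nu>) < \<infinity>"
      using that cont_dominated_finite[OF _ t] by (force simp: Upsilon2_def)
  qed measurable
qed

text \<open>Since v is quadratic in x, its expansion in the jump of x is exact. The diffusion and
  drift terms supply alpha A for \<open>scriptS\<close> and alpha b + A grad alpha for
  \<open>scriptM\<close>; the jumps supply the remaining integral of each.\<close>

lemma hamiltonian_v_opt:
  fixes \<nu> :: "(real^'n) measure" and \<alpha> \<beta> :: "real \<Rightarrow> real^'n \<Rightarrow> real"
    and b :: "real^'n \<Rightarrow> real^'n" and a \<gamma> :: "real^'n \<Rightarrow> real^'n^'n" and w x lam :: real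
    and y :: "real^'n"
  assumes T: "0 < T" and t: "t \<in> {0..T}"
    and sets: "sets \<nu> = sets borel" and sf: "sigma_finite_measure \<nu>"
    and A: "\<alpha> \<in> C12 T" "\<alpha> \<in> Upsilon0 T \<gamma> \<nu>" "\<alpha> \<in> Upsilon1 T \<gamma> \<nu>" "\<alpha> \<in> Upsilon2 T \<gamma> \<nu>"
    and B: "\<beta> \<in> C12 T" "\<beta> \<in> Upsilon2 T \<gamma> \<nu>"
    and F: "F \<in> sq_maps"
  defines "v \<equiv> v_opt w \<alpha> \<beta>"
    and "jump \<equiv> \<lambda>f. \<integral>e. f t (y + \<gamma> y *v e) - f t y - grad (f t) y \<bullet> (\<gamma> y *v e) \<partial>\<nu>"
  shows "integrable (\<nu> \<Otimes>\<^sub>M gauss) (jump_integrand \<gamma> v t x y F)"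
    and "hamiltonian b a \<gamma> \<nu> lam v t x y F =
      ereal ((\<integral>u. F u \<bullet> (scriptS a \<gamma> \<nu> \<alpha> t y *v F u) \<partial>gauss)
        + 2 * (x - w) * (mean_map F \<bullet> scriptM b a \<gamma> \<nu> \<alpha> t y) + ((x - w)\<^sup>2 * jump \<alpha> + jump \<beta>))
      - ereal lam * Ent F"
proof -
  define G where "G = \<gamma> y"
  define k where "k e = \<alpha> t (y + G *v e)" for e
  define d where "d e = k e - \<alpha> t y" for e
  define ra where "ra e = k e - \<alpha> t y - grad (\<alpha> t) y \<bullet> (G *v e)" for e
  define rb where "rb e = \<beta> t (y + G *v e) - \<beta> t y - grad (\<beta> t) y \<bullet> (G *v e)" for e
  define r where "r e = (x - w)\<^sup>2 * ra e + rb e" for e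
  note parts_a = integrable_jump_parts[OF sets A(1) t, where y = y and \<gamma> = \<gamma>]
  note parts_b = integrable_jump_parts[OF sets B(1) t, where y = y and \<gamma> = \<gamma>]
  have k: "k \<in> borel_measurable borel" "integrable \<nu> (\<lambda>e. k e * (norm e)\<^sup>2)"
    using parts_a(1,2) A by (simp_all add: k_def[abs_def] G_def)
  then have d: "d \<in> borel_measurable borel" "integrable \<nu> (\<lambda>e. d e * norm e)"
    using parts_a(3) A by (simp_all add: d_def[abs_def] k_def[abs_def] G_def)
  have ra: "integrable \<nu> ra" and rb: "integrable \<nu> rb"
    using parts_a(4) parts_b(4) A B by (simp_all add: ra_def[abs_def] rb_def[abs_def] k_def[abs_def] G_def)
  then have r: "integrable \<nu> r" "(\<integral>e. r e \<partial>\<nu>) = (x - w)\<^sup>2 * jump \<alpha> + jump \<beta>"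
    unfolding r_def[abs_def]
    by (simp_all add: jump_def ra_def[abs_def] rb_def[abs_def] k_def[abs_def] G_def)
  \<comment> \<open>With c = x - w and h = F u.(G e), expand k (c + h)^2. The compensator 2 c alpha
    h turns the linear coefficient k into d = k - alpha, which is what \<open>Upsilon1\<close> makes
    integrable.\<close>
  have J: "jump_integrand \<gamma> v t x y F =
    (\<lambda>(e, u). r e + (2 * (x - w)) * (d e * (F u \<bullet> (G *v e))) + k e * (F u \<bullet> (G *v e))\<^sup>2)"
    unfolding jump_integrand_def v_def v_opt_deriv_x v_opt_deriv_y[OF A(1) B(1) t T]
    by (simp add: fun_eq_iff v_opt_def r_def ra_def rb_def d_def k_def G_def power2_eq_square
        algebra_simps inner_add_left)
  note jmp = integral_jump[OF sets sf F r(1) d k, of "2 * (x - w)" G]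
  show "integrable (\<nu> \<Otimes>\<^sub>M gauss) (jump_integrand \<gamma> v t x y F)"
    unfolding J by (rule jmp(1))
  define K where "K = (\<integral>e. k e *\<^sub>R outer e e \<partial>\<nu>)"
  define D where "D = (\<integral>e. d e *\<^sub>R e \<partial>\<nu>)"
  have S: "scriptS a \<gamma> \<nu> \<alpha> t y = \<alpha> t y *\<^sub>R diffA a y + G ** K ** transpose G"
    by (simp add: scriptS_def K_def k_def G_def)
  have M: "scriptM b a \<gamma> \<nu> \<alpha> t y = \<alpha> t y *\<^sub>R b y + diffA a y *v grad (\<alpha> t) y + G *v D"
    by (simp add: scriptM_def D_def d_def k_def G_def)
  have FS: "(\<integral>u. F u \<bullet> (scriptS a \<gamma> \<nu> \<alpha> t y *v F u) \<partial>gauss) =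
      \<alpha> t y * (\<integral>u. F u \<bullet> (diffA a y *v F u) \<partial>gauss) + (\<integral>u. F u \<bullet> ((G ** K ** transpose G) *v F u) \<partial>gauss)"
    unfolding S matrix_vector_mult_add_rdistrib inner_add_right scaleR_matrix_vector_assoc[symmetric] inner_scaleR_right
    using integrable_quadratic_form[OF F] by simp
  have grad_x: "(\<chi> i. deriv (\<lambda>x'. grad (v t x') y $ i) x) = (2 * (x - w)) *\<^sub>R grad (\<alpha> t) y"
    unfolding v_def v_opt_deriv_y(3)[OF A(1) B(1) t T] by (simp add: vec_eq_iff)
  show "hamiltonian b a \<gamma> \<nu> lam v t x y F =
      ereal ((\<integral>u. F u \<bullet> (scriptS a \<gamma> \<nu> \<alpha> t y *v F u) \<partial>gauss)
        + 2 * (x - w) * (mean_map F \<bullet> scriptM b a \<gamma> \<nu> \<alpha> t y) + ((x - w)\<^sup>2 * jump \<alpha> + jump \<beta>))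
      - ereal lam * Ent F"
    unfolding hamiltonian_def grad_x J jmp(2) r(2) FS M mean_cov_quadratic_form[OF F] K_def[symmetric] D_def[symmetric]
    unfolding v_def v_opt_deriv_x
    by (simp add: matrix_vector_mult_scaleR inner_add_right algebra_simps)
qed

section \<open>Minimization and verification of the equation\<close>

text \<open>\<open>H\<close> is prescribed on \<open>sq_maps\<close> because for lam = 0 the
  minimizer is the constant m, which lies outside \<open>class_A\<close>. Its value is nevertheless
  the infimum over \<open>class_A\<close>.\<close>

lemma entropy_regularized_minimum:
  fixes S :: "real^'n^'n" and m :: "real^'n" and H :: "(real^'n \<Rightarrow> real^'n) \<Rightarrow> ereal"
  assumes S: "pos_def S" and lam: "0 \<le> lam"
    and H: "\<And>F. F \<in> sq_maps \<Longrightarrow>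
      H F = ereal ((\<integral>u. (F u - m) \<bullet> (S *v (F u - m)) \<partial>gauss) + C) - ereal lam * Ent F"
  defines "Fo \<equiv> \<lambda>u. m + mat_sqrt ((lam / 2) *\<^sub>R matrix_inv S) *v u"
    and "V \<equiv> ereal (C - lam / 2 * ln ((lam * pi) ^ CARD('n) / det S))"
  shows "H Fo = V" "(INF F\<in>class_A. H F) = V"
    and "0 < lam \<Longrightarrow> is_arg_min H (\<lambda>F. F \<in> class_A) Fo"
    and "lam = 0 \<Longrightarrow> is_arg_min H (\<lambda>F. F \<in> sq_maps) Fo"
proof -
  let ?cost = "\<lambda>F :: real^'n \<Rightarrow> real^'n. \<integral>u. (F u - m) \<bullet> (S *v (F u - m)) \<partial>gauss"
  have sq: "F \<in> sq_maps" if "F \<in> class_A" for F :: "real^'n \<Rightarrow> real^'n"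
    using that by (simp add: class_A_def)
  have Fo_sq: "Fo \<in> sq_maps" unfolding Fo_def by (rule sq_maps_affine)
  have "H Fo = V \<and> (INF F\<in>class_A. H F) = V \<and> (0 < lam \<longrightarrow> is_arg_min H (\<lambda>F. F \<in> class_A) Fo)
      \<and> (lam = 0 \<longrightarrow> is_arg_min H (\<lambda>F. F \<in> sq_maps) Fo)"
  proof (cases "0 < lam")
    case True
    note bound = entropy_quadratic_bound[OF S True, where m = m, folded Fo_def]
    have HFo: "H Fo = V"
      unfolding H[OF Fo_sq] V_def
      unfolding Fo_def entropy_quadratic_bound(3)[OF S True, where m = m] by simp
    \<comment> \<open>An entropy of -infinity gives \<open>H F\<close> = infinity, and +infinity is
      excluded by the bound, so the extended subtraction is harmless.\<close>
    have le: "V \<le> H F" if F: "F \<in> class_A" for F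
      unfolding H[OF sq[OF F]] V_def
      using bound(1)[OF F] by (cases "ereal lam * Ent F") auto
    have "(INF F\<in>class_A. H F) = V"
    proof (rule antisym)
      show "(INF F\<in>class_A. H F) \<le> V"
        unfolding HFo[symmetric] using bound(2) by (rule INF_lower)
      show "V \<le> (INF F\<in>class_A. H F)" using le by (rule INF_greatest)
    qed
    then show ?thesis using True HFo le bound(2) by (auto simp: is_arg_min_def not_less)
  next
    case False
    then have lam0: "lam = 0" using lam by simp
    \<comment> \<open>The factor lam / 2 is 0, so the degenerate logarithm contributes
      nothing.\<close>
    have V: "V = ereal C" by (simp add: V_def lam0)
    have Fo: "Fo = (\<lambda>_. m)" by (simp add: Fo_def lam0 mat_sqrt_0)
    \<comment> \<open>In \<open>ereal\<close> the product of 0 with an infinite value is 0, so the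
      entropy term drops out even when it is infinite.\<close>
    have H0: "H F = ereal (?cost F + C)" if "F \<in> sq_maps" for F
      unfolding H[OF that] lam0 by (simp flip: zero_ereal_def)
    have HFo: "H Fo = V" unfolding H0[OF Fo_sq] V by (simp add: Fo)
    have nonneg: "0 \<le> x \<bullet> (S *v x)" for x
      using pos_def_imp_pos_semidef[OF S] by (simp add: pos_semidef_def)
    have le: "V \<le> H F" if "F \<in> sq_maps" for F
      unfolding H0[OF that] V using nonneg by (simp add: integral_nonneg_AE)
    have "(INF F\<in>class_A. H F) \<le> V"
    proof (rule ereal_le_epsilon2)
      fix e :: real assume e: "0 < e"
      define q where "q = (\<integral>u. u \<bullet> (S *v u) \<partial>(gauss :: (real^'n) measure))"
      have q: "0 \<le> q" unfolding q_def using nonneg by (simp add: integral_nonneg_AE)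
      \<comment> \<open>The map m + s u costs s^2 q more than m; this s makes the excess e q / (1 +
        q), which is at most e.\<close>
      define s where "s = sqrt (e / (1 + q))"
      have s: "0 < s" "s\<^sup>2 * q \<le> e"
        using e q by (auto simp: s_def field_simps)
      define R where "R = s *\<^sub>R (mat 1 :: real^'n^'n)"
      have R: "R *v u = s *\<^sub>R u" for u
        by (simp add: R_def scaleR_matrix_vector_assoc[symmetric])
      have "invertible R" using s(1) by (simp add: invertible_det_nz R_def det_scaleR)
      then have "(\<lambda>u. m + R *v u) \<in> class_A" by (rule affine_class_A)
      then have "(INF F\<in>class_A. H F) \<le> H (\<lambda>u. m + R *v u)" by (rule INF_lower)
      also have "\<dots> = ereal (s\<^sup>2 * q + C)"
        unfolding H0[OF sq_maps_affine] by (simp add: R matrix_vector_mult_scaleR q_def power2_eq_square)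
      also have "\<dots> \<le> V + ereal e" using s(2) by (simp add: V)
      finally show "(INF F\<in>class_A. H F) \<le> V + ereal e" .
    qed
    moreover have "V \<le> (INF F\<in>class_A. H F)" using le sq by (intro INF_greatest) blast
    ultimately have "(INF F\<in>class_A. H F) = V" by (rule antisym)
    then show ?thesis using lam0 HFo le Fo_sq by (auto simp: is_arg_min_def not_less)
  qed
  then show "H Fo = V" "(INF F\<in>class_A. H F) = V"
    "0 < lam \<Longrightarrow> is_arg_min H (\<lambda>F. F \<in> class_A) Fo"
    "lam = 0 \<Longrightarrow> is_arg_min H (\<lambda>F. F \<in> sq_maps) Fo"
    by blast+
qed

text \<open>The minimum is expressed as an infimum over \<open>class_A\<close> together with the
  maps attaining it; for lam = 0 the optimal map is a minimizer over \<open>sq_maps\<close> with the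
  same value. Integrability of the jump integrand is asserted separately, since a Bochner integral
  would otherwise silently default to 0.\<close>

theorem proposition4p9:
  fixes T lam w :: real
    and \<nu> :: "(real ^ 'n) measure"
    and b :: "real ^ 'n \<Rightarrow> real ^ 'n"
    and a \<gamma> :: "real ^ 'n \<Rightarrow> real ^ 'n ^ 'n"
    and \<alpha> \<beta> :: "real \<Rightarrow> real ^ 'n \<Rightarrow> real"
  assumes "0 < T" and "0 \<le> lam"
    and "levy_measure \<nu>" and "(\<integral>\<^sup>+ e. ennreal ((norm e)\<^sup>2) \<partial>\<nu>) < \<infinity>"
    and "lipschitz_lin_growth b" and "lipschitz_lin_growth a" and "lipschitz_lin_growth \<gamma>"
    and "\<And>y. pos_def (Sigma_mat a \<gamma> \<nu> y)"
    and "\<alpha> \<in> C12 T \<inter> Upsilon2 T \<gamma> \<nu>" and "\<beta> \<in> C12 T \<inter> Upsilon2 T \<gamma> \<nu>"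
    and "\<alpha> \<in> Upsilon0 T \<gamma> \<nu> \<inter> Upsilon1 T \<gamma> \<nu>"
    and "\<And>t y. t \<in> {0..T} \<Longrightarrow> 0 < \<alpha> t y"
    and "\<And>t y. t \<in> {0..<T} \<Longrightarrow>
      dt T \<alpha> t y + L_Y b a \<gamma> \<nu> (\<alpha> t) y
      - scriptM b a \<gamma> \<nu> \<alpha> t y \<bullet> (matrix_inv (scriptS a \<gamma> \<nu> \<alpha> t y) *v scriptM b a \<gamma> \<nu> \<alpha> t y) = 0"
    and "\<And>t y. t \<in> {0..<T} \<Longrightarrow>
      dt T \<beta> t y + L_Y b a \<gamma> \<nu> (\<beta> t) y
      - lam / 2 * ln ((lam * pi) ^ CARD('n) / det (scriptS a \<gamma> \<nu> \<alpha> t y)) = 0"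
    and "\<And>y. \<alpha> T y = 1" and "\<And>y. \<beta> T y = 0"
  shows "let v = v_opt w \<alpha> \<beta>;
             H = hamiltonian b a \<gamma> \<nu> lam v;
             Fopt = F_opt b a \<gamma> \<nu> lam w \<alpha>
         in
      (\<lambda>t (x, y). v t x y) \<in> C12 T \<and>
      (\<forall>t\<in>{0..<T}. \<forall>x y.
         (\<forall>F\<in>sq_maps. integrable (\<nu> \<Otimes>\<^sub>M gauss) (jump_integrand \<gamma> v t x y F)) \<and>
         0 = ereal (dt T (\<lambda>s. v s x) t y + b y \<bullet> grad (v t x) y
                    + 1/2 * trace (diffA a y ** hess (v t x) y))
             + (INF F\<in>class_A. H t x y F)) \<and>
      (\<forall>x y. v T x y = (x - w)\<^sup>2) \<and>
      (\<forall>t\<in>{0..<T}. \<forall>x y.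
         H t x y (Fopt t x y) = (INF F\<in>class_A. H t x y F) \<and>
         (0 < lam \<longrightarrow> is_arg_min (H t x y) (\<lambda>F. F \<in> class_A) (Fopt t x y)) \<and>
         (lam = 0 \<longrightarrow> is_arg_min (H t x y) (\<lambda>F. F \<in> sq_maps) (Fopt t x y)))"
proof -
  note T = assms(1) and lam = assms(2) and levy = assms(3) and square = assms(4) and Sigma = assms(8)
  note pde_a = assms(13) and pde_b = assms(14) and terminal = assms(15,16)
  have A: "\<alpha> \<in> C12 T" "\<alpha> \<in> Upsilon0 T \<gamma> \<nu>" "\<alpha> \<in> Upsilon1 T \<gamma> \<nu>" "\<alpha> \<in> Upsilon2 T \<gamma> \<nu>"
    and B: "\<beta> \<in> C12 T" "\<beta> \<in> Upsilon2 T \<gamma> \<nu>"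
    using assms(9-11) by auto
  have sets: "sets \<nu> = sets borel" and zero: "emeasure \<nu> {0} = 0"
    using levy by (auto simp: levy_measure_def)
  have sf: "sigma_finite_measure \<nu>" by (rule sigma_finite_square_integrable[OF sets zero square])
  have sq: "integrable \<nu> (\<lambda>e. (norm e)\<^sup>2)"
    using square sets by (intro integrable_if_nn_integral_abs) (auto cong: measurable_cong_sets)
  define v where "v = v_opt w \<alpha> \<beta>"
  define H where "H = hamiltonian b a \<gamma> \<nu> lam v"
  define Fopt where "Fopt = F_opt b a \<gamma> \<nu> lam w \<alpha>"
  have main: "(\<forall>F\<in>sq_maps. integrable (\<nu> \<Otimes>\<^sub>M gauss) (jump_integrand \<gamma> v t x y F)) \<and>
      0 = ereal (dt T (\<lambda>s. v s x) t y + b y \<bullet> grad (v t x) y + 1/2 * trace (diffA a y ** hess (v t x) y))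
        + (INF F\<in>class_A. H t x y F) \<and>
      H t x y (Fopt t x y) = (INF F\<in>class_A. H t x y F) \<and>
      (0 < lam \<longrightarrow> is_arg_min (H t x y) (\<lambda>F. F \<in> class_A) (Fopt t x y)) \<and>
      (lam = 0 \<longrightarrow> is_arg_min (H t x y) (\<lambda>F. F \<in> sq_maps) (Fopt t x y))"
    if t: "t \<in> {0..<T}" for t x y
  proof -
    have t': "t \<in> {0..T}" using t by simp
    define S where "S = scriptS a \<gamma> \<nu> \<alpha> t y"
    define M where "M = scriptM b a \<gamma> \<nu> \<alpha> t y"
    define m where "m = m_opt b a \<gamma> \<nu> w \<alpha> t x y"
    define jump where "jump f = (\<integral>e. f t (y + \<gamma> y *v e) - f t y - grad (f t) y \<bullet> (\<gamma> y *v e) \<partial>\<nu>)"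
      for f :: "real \<Rightarrow> real^'n \<Rightarrow> real"
    \<comment> \<open>C collects the terms independent of F, and K is the contribution of the
      entropy, so the infimum is C - K.\<close>
    define C where "C = (x - w)\<^sup>2 * jump \<alpha> + jump \<beta> - (x - w)\<^sup>2 * (M \<bullet> (matrix_inv S *v M))"
    define K where "K = lam / 2 * ln ((lam * pi) ^ CARD('n) / det S)"
    note ham = hamiltonian_v_opt[OF T t' sets sf A B, where x = x and y = y and w = w, folded v_def]
    note parts = integrable_jump_parts[OF sets A(1) t', where y = y and \<gamma> = \<gamma>]
    \<comment> \<open>The weights are alpha at y and at the jump targets
      \<open>y + \<gamma> y *v e\<close>, all strictly positive.\<close>
    have S: "pos_def S"
      unfolding S_def scriptS_def diffA_def
      using Sigma[of y] assms(12)[OF t'] A(2) parts(1,2)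
      by (intro pos_def_weighted_sum sets sq) (auto simp: Sigma_mat_def diffA_def)
    have H: "H t x y F = ereal ((\<integral>u. (F u - m) \<bullet> (S *v (F u - m)) \<partial>gauss) + C) - ereal lam * Ent F"
      if "F \<in> sq_maps" for F
    proof -
      have m: "m = - (x - w) *\<^sub>R (matrix_inv S *v M)" by (simp add: m_def m_opt_def S_def M_def)
      show ?thesis
        unfolding H_def ham(2)[OF that] S_def[symmetric] M_def[symmetric] jump_def[symmetric]
          complete_square[OF S that] m[symmetric]
        by (simp add: C_def algebra_simps)
    qed
    note min = entropy_regularized_minimum[where H = "H t x y" and m = m and C = C, OF S lam H]
    have Fopt: "Fopt t x y = (\<lambda>u. m + mat_sqrt ((lam / 2) *\<^sub>R matrix_inv S) *v u)"
      by (simp add: Fopt_def F_opt_def m_def theta_opt_def S_def fun_eq_iff)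
    interpret tr: bounded_linear "\<lambda>X. trace (diffA a y ** X)" by (rule bounded_linear_trace_mul)
    have "trace (diffA a y ** (c *\<^sub>R X + Y)) = c * trace (diffA a y ** X) + trace (diffA a y ** Y)" for c X Y
      by (simp add: tr.add tr.scaleR)
    \<comment> \<open>Sorted by powers of x - w, the coefficient of the square is the left side of
      the equation for alpha and the remainder is that of the equation for beta; \<open>jump\<close>
      completes the local terms to \<open>L_Y\<close>.\<close>
    then have "dt T (\<lambda>s. v s x) t y + b y \<bullet> grad (v t x) y + 1/2 * trace (diffA a y ** hess (v t x) y) + (C - K)
      = (x - w)\<^sup>2 * (dt T \<alpha> t y + L_Y b a \<gamma> \<nu> (\<alpha> t) y - M \<bullet> (matrix_inv S *v M))
        + (dt T \<beta> t y + L_Y b a \<gamma> \<nu> (\<beta> t) y - K)"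
      unfolding v_def v_opt_deriv_y[OF A(1) B(1) t' T]
      by (simp add: L_Y_def C_def jump_def inner_add_right algebra_simps)
    also have "\<dots> = 0"
      using pde_a[OF t, of y] pde_b[OF t, of y] unfolding S_def M_def K_def by simp
    finally have "0 = ereal (dt T (\<lambda>s. v s x) t y + b y \<bullet> grad (v t x) y
        + 1/2 * trace (diffA a y ** hess (v t x) y)) + (INF F\<in>class_A. H t x y F)"
      by (subst min(2)) (simp_all add: K_def zero_ereal_def)
    then show ?thesis
      using ham(1) min unfolding Fopt by simp
  qed
  have "(\<lambda>t (x, y). v t x y) \<in> C12 T"
    unfolding v_def by (rule v_opt_C12[OF A(1) B(1) T])
  moreover have "v T x y = (x - w)\<^sup>2" for x y
    by (simp add: v_def v_opt_def terminal)
  ultimately show ?thesis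
    unfolding Let_def v_def[symmetric] H_def[symmetric] Fopt_def[symmetric]
    using main by blast
qed

end
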